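(* Let $p\ge 5$ be an integer, let $x$ be a right vertex of $T_H$, and let $f$ be any $2p$ distance coloring of $T_H$. Then the number of colors appearing on $\bigcup_{q=1}^{2\lfloor p/2\rfloor-1}\mathcal{F}_{x,p+q}$ that do not appear on $V(D_x^{2p})$ is at least $\lfloor p/2\rfloor$, i.e. $$\Big|\, f\Big(\bigcup_{q=1}^{2\lfloor p/2\rfloor-1}\mathcal{F}_{x,p+q}\Big)\setminus f\big(V(D_x^{2p})\big)\Big| \ \ge\ \Big\lfloor \frac p2\Big\rfloor .$$ Consequently $\lambda^{2p}(T_H)\ge |V(D_x^{2p})|+\lfloor p/2\rfloor$.
   Context: $T_H$ is the infinite hexagonal grid with vertex set $\mathbb{Z}^2$: $(i,j)$ is adjacent to $(i,j\pm1)$, and $(i,j)$ is adjacent to $(i+1,j)$ iff $i+j$ is even; no other edges. A vertex $(i,j)$ with $i+j$ even is called a right vertex. $d(u,v)$ is graph distance. For $l\in\mathbb{N}$, an $l$ distance coloring is a map $f:V(T_H)\to\{1,\dots,n\}$ with $f(u)\ne f(v)$ for all distinct $u,v$ with $d(u,v)\le l$; $\lambda^l(T_H)$ is the minimum such $n$. For a vertex $x$ and integer $k\ge0$, $\mathcal{F}_{x,k}=\{u\in V(T_H): d(x,u)=k\}$. $D_x^{2p}$ is the subgraph of $T_H$ induced by $\{w: d(w,x)\le p\}$ (the maximal induced subgraph all of whose vertices are within distance $p$ of $x$; any two of its vertices are within distance $2p$). *)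

theory Defs
  imports Main
begin

type_synonym vert = "int \<times> int"

definition hex_adj :: "vert \<Rightarrow> vert \<Rightarrow> bool" where
  "hex_adj u v \<longleftrightarrow>
     (fst u = fst v \<and> \<bar>snd u - snd v\<bar> = 1) \<or>
     (snd u = snd v \<and> fst v = fst u + 1 \<and> even (fst u + snd u)) \<or>
     (snd u = snd v \<and> fst u = fst v + 1 \<and> even (fst v + snd v))"

definition hexE :: "vert rel" where
  "hexE = {(u, v). hex_adj u v}"

definition right_vertex :: "vert \<Rightarrow> bool" where
  "right_vertex v \<longleftrightarrow> even (fst v + snd v)"

(* graph distance: length of a shortest walk (T_H is connected) *)
definition hdist :: "vert \<Rightarrow> vert \<Rightarrow> nat" where
  "hdist u v = (LEAST n. (u, v) \<in> hexE ^^ n)"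

definition sphere :: "vert \<Rightarrow> nat \<Rightarrow> vert set" where
  "sphere x k = {u. hdist x u = k}"

definition Dball :: "vert \<Rightarrow> nat \<Rightarrow> vert set" where
  "Dball x p = {w. hdist w x \<le> p}"

definition dist_coloring :: "nat \<Rightarrow> nat \<Rightarrow> (vert \<Rightarrow> nat) \<Rightarrow> bool" where
  "dist_coloring l n f \<longleftrightarrow>
     (\<forall>u. f u \<in> {1..n}) \<and>
     (\<forall>u v. u \<noteq> v \<and> hdist u v \<le> l \<longrightarrow> f u \<noteq> f v)"

definition hex_lambda :: "nat \<Rightarrow> nat" where
  "hex_lambda l = (LEAST n. \<exists>f. dist_coloring l n f)"

end

theory Submission
  imports Complex_Main Defs
begin

text \<open>
  A linear programming dual. Give every vertex within distance \<open>p + 2 * (p div 2) - 1\<close> of \<open>x\<close> a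
  nonnegative weight, such that every set of vertices at pairwise distance more than \<open>2 * p\<close> has total
  weight at most \<open>W\<close>. A colour class is such a set, so at least (total weight) / \<open>W\<close> colours occur there.
  The weights fall off linearly from \<open>x\<close> in the hexagonal norm that is turned by 30 degrees against the
  graph distance: in the scaling limit a colour class is a packing by regular hexagons, and this tent
  function sums to at most its peak over every packing, with equality for the hexagonal tiling.
  The term \<open>p div 2\<close> comes from the lattice: two vertices in the same class of the bipartition have even distance,
  hence at least \<open>2 * p + 2\<close> if their colours agree, and among three mutually neighbouring
  vertices of one colour two are in the same class.
  A few vertices on the axes of symmetry, where the bound would be missed by one unit, lose half a unit of weight
  (all weights are doubled below to stay integral), and the weights near \<open>x\<close> are raised to \<open>W\<close>.

  To bound the weight of a colour class, split the plane around \<open>x\<close> into six sextants by the signs of the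
  three hexagonal coordinates. Each sextant contains at most one vertex of the class, and every
  configuration of occupied sextants is settled by linear arithmetic.
\<close>

section \<open>Graph distance\<close>

definition par :: "vert \<Rightarrow> int" where
  "par v = (fst v + snd v) mod 2"

text \<open>A closed form of the graph distance. The first term counts the columns and rows to be
  crossed; for the second, \<open>2 * fst v - par v\<close> changes by exactly one along every
  edge.\<close>

definition hex_dist :: "vert \<Rightarrow> vert \<Rightarrow> int" where
  "hex_dist u v = max (\<bar>fst u - fst v\<bar> + \<bar>snd u - snd v\<bar>) \<bar>2 * (fst u - fst v) - (par u - par v)\<bar>"

lemma hex_dist_self [simp]: "hex_dist u u = 0"
  by (simp add: hex_dist_def)

lemma hex_dist_nonneg [simp]: "0 \<le> hex_dist u v"
  by (auto simp: hex_dist_def)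

lemma hex_dist_commute: "hex_dist u v = hex_dist v u"
  by (simp add: hex_dist_def abs_minus_commute)

lemma hex_dist_eq_0: "hex_dist u v = 0 \<Longrightarrow> u = v"
  by (auto simp: hex_dist_def max_def prod_eq_iff split: if_splits)

lemma par_cases: "par v = 0 \<or> par v = 1"
  by (auto simp: par_def)

lemma hex_adj_par:
  "hex_adj u w \<longleftrightarrow> fst w = fst u \<and> (snd w = snd u + 1 \<or> snd w = snd u - 1) \<or>
    snd w = snd u \<and> fst w = fst u + 1 - 2 * par u"
proof -
  have "par u = (if even (fst u + snd u) then 0 else 1)"
    by (simp add: par_def mod2_eq_if)
  moreover have "even (fst w + snd u) \<longleftrightarrow> odd (fst u + snd u)" if "fst u = fst w + 1"
    using that by simp
  ultimately show ?thesis
    unfolding hex_adj_def by (cases "even (fst u + snd u)") auto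
qed

lemma par_adj: "hex_adj u w \<Longrightarrow> par w = 1 - par u"
  by (auto simp: hex_adj_par par_def mod2_eq_if split: if_splits)

lemma hex_dist_step: "hex_adj u w \<Longrightarrow> hex_dist u v \<le> hex_dist w v + 1"
  using par_cases[of u] par_adj[of u w] unfolding hex_adj_par hex_dist_def by (smt (verit))

lemma hex_dist_descend:
  assumes "hex_dist u v > 0"
  shows "\<exists>w. hex_adj u w \<and> hex_dist w v = hex_dist u v - 1"
proof -
  define a b where "a = fst u - fst v" and "b = snd u - snd v"
  \<comment> \<open>Parity excludes, for instance, two vertices of one class in the same row and in
    consecutive columns, where a vertical step need not shorten the distance.\<close>
  obtain q where q: "a + b - (par u - par v) = 2 * q"
    unfolding a_def b_def par_def by (metis evenE even_add even_diff even_mod_2_iff)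
  \<comment> \<open>Greedy choice: the horizontal edge at \<open>u\<close> if it leads towards the
    column of \<open>v\<close>, otherwise a vertical step towards the row of \<open>v\<close>. If
    that row is already reached, either vertical neighbour serves.\<close>
  define w where "w = (if par u = 0 \<and> a < 0 \<or> par u = 1 \<and> a > 0 then (fst u + 1 - 2 * par u, snd u)
    else if b < 0 then (fst u, snd u + 1) else (fst u, snd u - 1))"
  have adj: "hex_adj u w"
    by (simp add: hex_adj_par w_def)
  have "hex_dist w v = hex_dist u v - 1"
  proof (cases "par u = 0 \<and> a < 0 \<or> par u = 1 \<and> a > 0")
    case True
    then have "hex_dist w v = max (\<bar>a + 1 - 2 * par u\<bar> + \<bar>b\<bar>) \<bar>2 * (a + 1 - 2 * par u) - (1 - par u - par v)\<bar>"
      by (simp add: hex_dist_def par_adj[OF adj]) (simp add: w_def a_def b_def algebra_simps)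
    then show ?thesis
      using True par_cases[of v] unfolding hex_dist_def a_def[symmetric] b_def[symmetric] by (smt (verit))
  next
    case False
    then have *: "hex_dist w v = max (\<bar>a\<bar> + \<bar>if b < 0 then b + 1 else b - 1\<bar>) \<bar>2 * a - (1 - par u - par v)\<bar>"
      by (simp add: hex_dist_def par_adj[OF adj]) (auto simp add: w_def a_def b_def algebra_simps)
    have "par u = 0 \<and> a \<ge> 0 \<or> par u = 1 \<and> a \<le> 0"
      using False par_cases[of u] by linarith
    then show ?thesis
      using assms * q par_cases[of v] unfolding hex_dist_def a_def[symmetric] b_def[symmetric] by (smt (verit))
  qed
  with adj show ?thesis by blast
qed

lemma hex_dist_walk: "(u, v) \<in> hexE ^^ n \<Longrightarrow> hex_dist u v \<le> int n"
proof (induction n arbitrary: u)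
  case (Suc n)
  then obtain w where "(u, w) \<in> hexE" "(w, v) \<in> hexE ^^ n"
    by (meson relpow_Suc_E2)
  then show ?case
    using Suc.IH[of w] hex_dist_step[of u w v] by (simp add: hexE_def)
qed simp

lemma walk_hex_dist: "hex_dist u v = int n \<Longrightarrow> (u, v) \<in> hexE ^^ n"
proof (induction n arbitrary: u)
  case 0
  then show ?case using hex_dist_eq_0 by auto
next
  case (Suc n)
  then obtain w where "hex_adj u w" "hex_dist w v = int n"
    using hex_dist_descend[of u v] by auto
  then show ?case
    using Suc.IH[of w] by (metis case_prodI hexE_def mem_Collect_eq relpow_Suc_I2)
qed

lemma hdist_eq_hex_dist: "int (hdist u v) = hex_dist u v"
proof -
  have "hdist u v = nat (hex_dist u v)"
    unfolding hdist_def
    by (rule Least_equality) (use hex_dist_walk[of u v] in \<open>auto intro: walk_hex_dist simp: nat_le_iff\<close>)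
  then show ?thesis by simp
qed

section \<open>Far points in different sextants\<close>

text \<open>
  A vertex is a point of the cubic lattice with coordinate sum 0 (right vertices) or 1 (left vertices), and
  the sextants are numbered cyclically. In an even sextant one coordinate is positive and two are not, in an odd
  sextant it is the other way round. A profile records the absolute value of the coordinate whose sign is
  alone (\<open>ncrd\<close>) and of the two others, the type, and an upper bound of the differences of coordinates. Real numbers
  suffice for all the inequalities except the cases of equality, which need \<open>one_gap\<close>.
\<close>

datatype profile = Profile (ncrd: "real") (bcrd: "real") (gcrd: "real") (ptype: "real") (pheight: "real")

text \<open>The linear constraints that sextant, type, height and a norm of at most
  \<open>2 * p - 1\<close> impose on a profile; see \<open>cell_profile_at\<close>.\<close>

definition cell :: "real \<Rightarrow> bool \<Rightarrow> profile \<Rightarrow> bool" where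
  "cell p e X \<longleftrightarrow> (ptype X = 0 \<or> ptype X = 1) \<and> ncrd X + bcrd X \<le> pheight X \<and> ncrd X + gcrd X \<le> pheight X \<and>
    (if e then 0 \<le> bcrd X \<and> 0 \<le> gcrd X \<and> ncrd X = bcrd X + gcrd X + ptype X \<and> ncrd X \<le> p - 1 + ptype X
     else 1 \<le> bcrd X \<and> 1 \<le> gcrd X \<and> bcrd X + gcrd X = ncrd X + ptype X \<and> ncrd X \<le> p - 1)"

text \<open>
  The condition that two vertices of types \<open>tx\<close>, \<open>ty\<close> are more than \<open>2 * p\<close> apart, along a coordinate
  with value \<open>x\<close> at the first vertex and \<open>- y\<close> at the second. The indices in \<open>far1\<close>, \<open>far2\<close>, \<open>far3\<close> and
  in the names of the lemmas below are (differences of) sextant numbers.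
\<close>

definition far_pn :: "real \<Rightarrow> real \<Rightarrow> real \<Rightarrow> real \<Rightarrow> real \<Rightarrow> bool" where
  "far_pn p x tx y ty \<longleftrightarrow> p + tx \<le> x + y \<and> p + 1 - ty \<le> x + y"

definition far1 :: "real \<Rightarrow> bool \<Rightarrow> profile \<Rightarrow> profile \<Rightarrow> bool" where
  "far1 p e X Y \<longleftrightarrow> (if e then far_pn p (gcrd Y) (ptype Y) (bcrd X) (ptype X)
     else far_pn p (bcrd X) (ptype X) (gcrd Y) (ptype Y))"

definition far2 :: "real \<Rightarrow> bool \<Rightarrow> profile \<Rightarrow> profile \<Rightarrow> bool" where
  "far2 p e X Y \<longleftrightarrow> (if e then far_pn p (ncrd X) (ptype X) (gcrd Y) (ptype Y) \<or> far_pn p (ncrd Y) (ptype Y) (bcrd X) (ptype X)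
     else far_pn p (gcrd Y) (ptype Y) (ncrd X) (ptype X) \<or> far_pn p (bcrd X) (ptype X) (ncrd Y) (ptype Y))"

definition far3 :: "real \<Rightarrow> bool \<Rightarrow> profile \<Rightarrow> profile \<Rightarrow> bool" where
  "far3 p e X Y \<longleftrightarrow> (if e then far_pn p (ncrd X) (ptype X) (ncrd Y) (ptype Y)
     else far_pn p (ncrd Y) (ptype Y) (ncrd X) (ptype X))"

section \<open>Height bounds for each pattern of occupied sextants\<close>

lemmas cell_defs = cell_def far1_def far2_def far3_def far_pn_def

text \<open>The vertices on the symmetry axis of their sextant whose type fits its parity. The
  extremal configurations of \<open>pair3\<close> and \<open>triple024\<close> contain two of
  them.\<close>

definition axial :: "bool \<Rightarrow> profile \<Rightarrow> bool" where
  "axial e X \<longleftrightarrow> bcrd X = gcrd X \<and> ptype X = (if e then 0 else 1)"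

definition one_gap :: "profile \<Rightarrow> bool" where
  "one_gap X \<longleftrightarrow> bcrd X = gcrd X \<or> bcrd X + 1 \<le> gcrd X \<or> gcrd X + 1 \<le> bcrd X"

text \<open>The thresholds come from the bound \<open>cap p\<close> on tent sums: for
  \<open>k\<close> vertices, twice the sum of the heights has to reach
  \<open>k * peak p - cap p\<close>, which is \<open>(k - 1) * (3 * p + 2)\<close> for even
  \<open>p\<close> and \<open>(k - 1) * (3 * p + 1) + 2\<close> for odd \<open>p\<close>. Small
  defects are repaired later by parity or by the correction at axial vertices.\<close>

lemma pair1:
  assumes "cell p e X" "cell p (\<not> e) Y" "far1 p e X Y"
  shows "2 * (pheight X + pheight Y) \<ge> 3 * p + 2"
  using assms unfolding cell_defs by (cases e; simp only: simp_thms if_True if_False; argo)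

lemma pair2:
  assumes "cell p e X" "cell p e Y" "far2 p e X Y"
  shows "2 * (pheight X + pheight Y) \<ge> 3 * p + 2"
  using assms unfolding cell_defs by (cases e; simp only: simp_thms if_True if_False; argo)

text \<open>The larger of \<open>bcrd\<close> and \<open>gcrd\<close> is at least half their sum, so
  twice a height is at least \<open>3 * ncrd\<close> minus the type in an even sextant and plus the
  type in an odd one. With the far condition this falls below \<open>3 * p + 2\<close> only for type
  0 in the even and type 1 in the odd sextant.\<close>

lemma pair3:
  assumes "cell p e X" "cell p (\<not> e) Y" "far3 p e X Y"
  shows "2 * (pheight X + pheight Y) \<ge> 3 * p + 1"
  using assms unfolding cell_defs by (cases e; simp only: simp_thms if_True if_False; argo)

text \<open>If \<open>bcrd\<close> and \<open>gcrd\<close> differ, they differ by at least one, and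
  the half-sum estimate of \<open>pair3\<close> gains the missing unit.\<close>

lemma pair3_tight:
  assumes "cell p e X" "cell p (\<not> e) Y" "far3 p e X Y" "one_gap X" "one_gap Y"
  shows "2 * (pheight X + pheight Y) \<ge> 3 * p + 2 \<or> axial e X \<and> axial (\<not> e) Y"
  using assms unfolding cell_defs axial_def one_gap_def by (cases e; simp only: simp_thms if_True if_False; argo)

text \<open>\<open>far_pn\<close> is as weak as \<open>p\<close> only for types 0 and 1 in this
  order. If the three conditions run cyclically, at most one is weak, and adding them gives
  \<open>3 * p + 2\<close>. Only a transitive orientation, where one vertex contributes its
  \<open>ncrd\<close> twice, can be tighter.\<close>

lemma triple024:
  assumes "cell p e X" "cell p e Y" "cell p e Z" "far2 p e X Y" "far2 p e Y Z" "far2 p e Z X"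
  shows "pheight X + pheight Y + pheight Z > 3 * p"
  using assms unfolding cell_defs by (cases e; simp only: simp_thms if_True if_False; argo)

lemma triple024_tight:
  assumes "cell p e X" "cell p e Y" "cell p e Z" "far2 p e X Y" "far2 p e Y Z" "far2 p e Z X"
    "one_gap X" "one_gap Y" "one_gap Z" "pheight X + pheight Y + pheight Z \<le> 3 * p + 1"
  shows "axial e X \<and> p + 1 \<le> pheight X \<and> axial e Y \<and> p + 1 \<le> pheight Y \<or>
    axial e Y \<and> p + 1 \<le> pheight Y \<and> axial e Z \<and> p + 1 \<le> pheight Z \<or>
    axial e Z \<and> p + 1 \<le> pheight Z \<and> axial e X \<and> p + 1 \<le> pheight X"
  using assms unfolding cell_defs axial_def one_gap_def by (cases e; simp only: simp_thms if_True if_False; argo)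

lemma triple012:
  assumes "cell p e X" "cell p (\<not> e) Y" "cell p e Z" "far1 p e X Y" "far1 p (\<not> e) Y Z"
  shows "pheight X + pheight Y + pheight Z \<ge> 3 * p + 2"
  using assms unfolding cell_defs by (cases e; simp only: simp_thms if_True if_False; argo)

lemma triple013:
  assumes "cell p e X" "cell p (\<not> e) Y" "cell p (\<not> e) Z" "far1 p e X Y" "far2 p (\<not> e) Y Z" "far3 p e X Z"
  shows "pheight X + pheight Y + pheight Z \<ge> 3 * p + 2"
  using assms unfolding cell_defs by (cases e; simp only: simp_thms if_True if_False; argo)

lemma triple023:
  assumes "cell p e X" "cell p e Y" "cell p (\<not> e) Z" "far2 p e X Y" "far1 p e Y Z" "far3 p e X Z"
  shows "pheight X + pheight Y + pheight Z \<ge> 3 * p + 2"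
  using assms unfolding cell_defs by (cases e; simp only: simp_thms if_True if_False; argo)

lemma quad0123:
  assumes "cell p e X" "cell p (\<not> e) Y" "cell p e Z" "cell p (\<not> e) U" "far1 p e X Y" "far1 p (\<not> e) Y Z" "far1 p e Z U"
  shows "2 * (pheight X + pheight Y + pheight Z + pheight U) \<ge> 9 * p + 5"
  using assms unfolding cell_defs by (cases e; simp only: simp_thms if_True if_False; argo)

lemma quad0124:
  assumes "cell p e X" "cell p (\<not> e) Y" "cell p e Z" "cell p e U" "far1 p e X Y" "far1 p (\<not> e) Y Z"
    "far2 p e Z U" "far2 p e U X" "far3 p (\<not> e) Y U"
  shows "2 * (pheight X + pheight Y + pheight Z + pheight U) \<ge> 9 * p + 5"
  using assms unfolding cell_defs by (cases e; simp only: simp_thms if_True if_False; argo)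

lemma quad0134:
  assumes "cell p e X" "cell p (\<not> e) Y" "cell p (\<not> e) Z" "cell p e U" "far1 p e X Y" "far2 p (\<not> e) Y Z"
    "far1 p (\<not> e) Z U" "far2 p e U X" "far3 p e X Z" "far3 p (\<not> e) Y U"
  shows "2 * (pheight X + pheight Y + pheight Z + pheight U) \<ge> 9 * p + 5"
  using assms unfolding cell_defs by (cases e; simp only: simp_thms if_True if_False; argo)

lemma quint01234:
  assumes "cell p e X" "cell p (\<not> e) Y" "cell p e Z" "cell p (\<not> e) U" "cell p e V"
    "far1 p e X Y" "far1 p (\<not> e) Y Z" "far1 p e Z U" "far1 p (\<not> e) U V"
  shows "pheight X + pheight Y + pheight Z + pheight U + pheight V \<ge> 6 * p + 4"
  using assms unfolding cell_defs by (cases e; simp only: simp_thms if_True if_False; argo)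

lemma sext012345:
  assumes "cell p e X" "cell p (\<not> e) Y" "cell p e Z" "cell p (\<not> e) U" "cell p e V" "cell p (\<not> e) T"
    "far1 p e X Y" "far1 p (\<not> e) Y Z" "far1 p e Z U" "far1 p (\<not> e) U V" "far1 p e V T" "far1 p (\<not> e) T X"
  shows "2 * (pheight X + pheight Y + pheight Z + pheight U + pheight V + pheight T) \<ge> 15 * p + 10"
  using assms unfolding cell_defs by (cases e; simp only: simp_thms if_True if_False; argo)

section \<open>Hexagonal coordinates\<close>

abbreviation hex_norm :: "vert \<Rightarrow> int" where
  "hex_norm v \<equiv> hex_dist v (0, 0)"

text \<open>Neighbouring vertices agree in two of these coordinates and differ by one in the third,
  which places the grid in the cubic lattice. The divisions are exact by
  \<open>par_half\<close>.\<close>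

definition cube :: "vert \<Rightarrow> nat \<Rightarrow> int" where
  "cube v i = (if i mod 3 = 0 then fst v
     else if i mod 3 = 1 then (par v - fst v + snd v) div 2 else (par v - fst v - snd v) div 2)"

text \<open>The largest difference of two of the coordinates \<open>cube v i\<close>.\<close>

definition height :: "vert \<Rightarrow> int" where
  "height v = max \<bar>snd v\<bar> ((\<bar>3 * fst v - par v\<bar> + \<bar>snd v\<bar>) div 2)"

lemma par_origin [simp]: "par (0, 0) = 0"
  by (simp add: par_def)

lemma par_half: "\<exists>q. par v = fst v + snd v - 2 * q"
  unfolding par_def by (metis minus_mod_eq_mult_div [symmetric] add_diff_cancel_left' diff_diff_eq2 minus_mult_div_eq_mod)

lemma hex_norm_eq: "hex_norm v = max (\<bar>fst v\<bar> + \<bar>snd v\<bar>) \<bar>2 * fst v - par v\<bar>"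
  by (simp add: hex_dist_def)

lemma hex_norm_ge: "\<bar>fst v\<bar> + \<bar>snd v\<bar> \<le> hex_norm v" "\<bar>2 * fst v - par v\<bar> \<le> hex_norm v"
  by (simp_all add: hex_norm_eq)

lemma hex_dist_triangle: "hex_dist u v \<le> hex_norm u + hex_norm v"
proof -
  have "\<bar>fst u - fst v\<bar> + \<bar>snd u - snd v\<bar> \<le> hex_norm u + hex_norm v"
    using hex_norm_ge(1)[of u] hex_norm_ge(1)[of v] by linarith
  moreover have "\<bar>2 * (fst u - fst v) - (par u - par v)\<bar> = \<bar>(2 * fst u - par u) - (2 * fst v - par v)\<bar>"
    by simp
  then have "\<bar>2 * (fst u - fst v) - (par u - par v)\<bar> \<le> hex_norm u + hex_norm v"
    using abs_triangle_ineq4[of "2 * fst u - par u" "2 * fst v - par v"] hex_norm_ge(2)[of u] hex_norm_ge(2)[of v]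
    by linarith
  ultimately show ?thesis
    by (simp add: hex_dist_def[of u v])
qed

lemma cube_mod: "i mod 3 = j mod 3 \<Longrightarrow> cube v i = cube v j"
  by (simp add: cube_def)

lemma cube_0: "cube v 0 = fst v"
  by (simp add: cube_def)

lemma cube_1: "2 * cube v (Suc 0) = par v - fst v + snd v"
  using par_half[of v] by (auto simp: cube_def)

lemma cube_2: "2 * cube v 2 = par v - fst v - snd v"
  using par_half[of v] by (auto simp: cube_def)

lemma index_cases:
  fixes i :: nat
  obtains "i mod 3 = 0" "(i + 1) mod 3 = 1" "(i + 2) mod 3 = 2"
    | "i mod 3 = 1" "(i + 1) mod 3 = 2" "(i + 2) mod 3 = 0"
    | "i mod 3 = 2" "(i + 1) mod 3 = 0" "(i + 2) mod 3 = 1"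
proof -
  have "i mod 3 < 3" by simp
  then consider "i mod 3 = 0" | "i mod 3 = 1" | "i mod 3 = 2" by linarith
  then show ?thesis
    using that by cases (simp_all add: mod_Suc)
qed

lemma cube_sum: "cube v i + cube v (i + 1) + cube v (i + 2) = par v"
proof -
  have *: "cube v 0 + cube v 1 + cube v 2 = par v"
    using cube_0[of v] cube_1[of v] cube_2[of v] by simp
  have m: "cube v j = cube v (j mod 3)" for j
    by (simp add: cube_def)
  show ?thesis
    unfolding m[of i] m[of "i + 1"] m[of "i + 2"] using * by (cases i rule: index_cases) (simp_all only: ac_simps)
qed

lemma cube_cases:
  assumes "P (cube v 0)" "P (cube v (Suc 0))" "P (cube v 2)"
  shows "P (cube v i)"
proof -
  have "i mod 3 < 3" by simp
  then consider "i mod 3 = 0" | "i mod 3 = 1" | "i mod 3 = 2" by linarith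
  then show ?thesis
    using assms cube_mod[of i 0 v] cube_mod[of i 1 v] cube_mod[of i 2 v] by cases simp_all
qed

lemma height_le_iff: "height v \<le> k \<longleftrightarrow> \<bar>snd v\<bar> \<le> k \<and> \<bar>3 * fst v - par v\<bar> + \<bar>snd v\<bar> \<le> 2 * k"
proof -
  obtain q where "par v = fst v + snd v - 2 * q" using par_half by blast
  then have "3 * fst v - par v + snd v = 2 * (fst v + q)" by simp
  then have "even (\<bar>3 * fst v - par v\<bar> + \<bar>snd v\<bar>)"
    by (metis dvd_triv_left even_abs_add_iff even_add_abs_iff)
  then obtain e where "\<bar>3 * fst v - par v\<bar> + \<bar>snd v\<bar> = 2 * e"
    by (elim evenE)
  then show ?thesis
    by (simp add: height_def)
qed

lemma height_ge: "\<bar>snd v\<bar> \<le> height v" "\<bar>3 * fst v - par v\<bar> + \<bar>snd v\<bar> \<le> 2 * height v"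
  using height_le_iff[of v "height v"] by simp_all

lemma cube_diff_le_height: "cube v i - cube v j \<le> height v"
  by (rule cube_cases[where P = "\<lambda>x. x - cube v j \<le> height v"];
      rule cube_cases[where P = "\<lambda>x. _ - x \<le> height v"])
    (use height_ge[of v] cube_0[of v] cube_1[of v] cube_2[of v] in linarith)+

text \<open>The two coordinates other than \<open>c = cube v i\<close> sum to
  \<open>par v - c\<close>, so the norm, being the sum of the three absolute values, is at least
  \<open>\<bar>c\<bar> + \<bar>par v - c\<bar>\<close>.\<close>

lemma cube_bound:
  assumes "hex_norm v \<le> 2 * p - 1"
  shows "1 - p \<le> cube v i \<and> cube v i \<le> p - 1 + par v"
  by (rule cube_cases[where P = "\<lambda>x. 1 - p \<le> x \<and> x \<le> p - 1 + par v"])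
    (use assms hex_norm_ge[of v] par_cases[of v] cube_0[of v] cube_1[of v] cube_2[of v] in linarith)+

text \<open>The coordinates as seen from sextant \<open>k\<close>, where the sign of
  \<open>xc k\<close> is alone. Passing to the next sextant flips only the sign of
  \<open>yc k\<close> and leaves \<open>zc k\<close> as the lone one, whence the index
  \<open>2 * k\<close>.\<close>

definition xc :: "nat \<Rightarrow> vert \<Rightarrow> int" where "xc k v = cube v (2 * k)"
definition yc :: "nat \<Rightarrow> vert \<Rightarrow> int" where "yc k v = cube v (2 * k + 1)"
definition zc :: "nat \<Rightarrow> vert \<Rightarrow> int" where "zc k v = cube v (2 * k + 2)"

lemma coord_Suc [simp]: "xc (Suc k) = zc k" "yc (Suc k) = xc k" "zc (Suc k) = yc k"
  by (auto simp: fun_eq_iff xc_def yc_def zc_def intro!: cube_mod) presburger+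

lemma coord_sum: "xc k v + yc k v + zc k v = par v"
  unfolding xc_def yc_def zc_def by (rule cube_sum)

section \<open>The far condition in one coordinate, and its form in the sextants\<close>

definition farc :: "int \<Rightarrow> (vert \<Rightarrow> int) \<Rightarrow> vert \<Rightarrow> vert \<Rightarrow> bool" where
  "farc p c u v \<longleftrightarrow> p + par u \<le> c u - c v \<and> p + 1 - par v \<le> c u - c v"

text \<open>The three coordinate differences sum to \<open>par u - par v\<close>, so the one whose
  sign is alone carries half the distance. Equal types have even distance, hence at least
  \<open>2 * p + 2\<close>; rounding gives \<open>p + 1\<close>, and \<open>p\<close> only when the
  larger coordinate has type 0 and the smaller has type 1.\<close>

lemma far_farc_0:
  assumes "2 * p < hex_dist u v"
  shows "farc p (xc 0) u v \<or> farc p (xc 0) v u \<or> farc p (yc 0) u v \<or> farc p (yc 0) v u \<or>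
    farc p (zc 0) u v \<or> farc p (zc 0) v u"
  using assms par_cases[of u] par_cases[of v] cube_0[of u] cube_0[of v] cube_1[of u] cube_1[of v] cube_2[of u] cube_2[of v]
  unfolding farc_def hex_dist_def xc_def yc_def zc_def mult_0_right add_0 One_nat_def by (smt (verit))

lemma far_farc:
  assumes "2 * p < hex_dist u v"
  shows "farc p (xc k) u v \<or> farc p (xc k) v u \<or> farc p (yc k) u v \<or> farc p (yc k) v u \<or>
    farc p (zc k) u v \<or> farc p (zc k) v u"
  by (induction k) (use far_farc_0[OF assms] in auto)

text \<open>The window of \<open>cube_bound\<close> reaches less than \<open>p\<close> to the
  negative side and less than \<open>p + par u\<close> to the positive side of zero, so a far pair
  has values on both sides.\<close>

lemma farc_sign:
  assumes "farc p c u v" "c = xc k \<or> c = yc k \<or> c = zc k" "hex_norm u \<le> 2 * p - 1" "hex_norm v \<le> 2 * p - 1"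
  shows "1 \<le> c u \<and> c v \<le> 0"
proof -
  obtain i where c: "c = (\<lambda>v. cube v i)"
    using assms(2) unfolding xc_def yc_def zc_def by (auto simp: fun_eq_iff)
  show ?thesis
    using assms(1) par_cases[of v] cube_bound[OF assms(3), of i] cube_bound[OF assms(4), of i]
    unfolding farc_def c by linarith
qed

lemma far_cases:
  assumes "2 * p < hex_dist u v" "hex_norm u \<le> 2 * p - 1" "hex_norm v \<le> 2 * p - 1"
  obtains "farc p (xc k) u v" "1 \<le> xc k u" "xc k v \<le> 0" | "farc p (xc k) v u" "1 \<le> xc k v" "xc k u \<le> 0"
    | "farc p (yc k) u v" "1 \<le> yc k u" "yc k v \<le> 0" | "farc p (yc k) v u" "1 \<le> yc k v" "yc k u \<le> 0"
    | "farc p (zc k) u v" "1 \<le> zc k u" "zc k v \<le> 0" | "farc p (zc k) v u" "1 \<le> zc k v" "zc k u \<le> 0"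
  using far_farc[OF assms(1), of k] farc_sign[of p _ u v k] farc_sign[of p _ v u k] assms(2,3) by metis

text \<open>Zero counts as nonpositive. As the coordinates sum to 0 or 1, they are never all
  positive, and all nonpositive only at the origin; the six sextants partition the other
  vertices.\<close>

definition sextant :: "nat \<Rightarrow> vert \<Rightarrow> bool" where
  "sextant k v \<longleftrightarrow> (if even k then 1 \<le> xc k v \<and> yc k v \<le> 0 \<and> zc k v \<le> 0
     else xc k v \<le> 0 \<and> 1 \<le> yc k v \<and> 1 \<le> zc k v)"

definition profile_at :: "nat \<Rightarrow> vert \<Rightarrow> profile" where
  "profile_at k v = (let s = (- 1) ^ k in Profile (s * xc k v) (- s * yc k v) (- s * zc k v) (par v) (height v))"

lemma profile_at_simps:
  "even k \<Longrightarrow> ncrd (profile_at k v) = xc k v" "odd k \<Longrightarrow> ncrd (profile_at k v) = - xc k v"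
  "even k \<Longrightarrow> bcrd (profile_at k v) = - yc k v" "odd k \<Longrightarrow> bcrd (profile_at k v) = yc k v"
  "even k \<Longrightarrow> gcrd (profile_at k v) = - zc k v" "odd k \<Longrightarrow> gcrd (profile_at k v) = zc k v"
  "ptype (profile_at k v) = par v" "pheight (profile_at k v) = height v"
  by (simp_all add: profile_at_def Let_def)

lemma one_gap_profile_at: "one_gap (profile_at k v)"
proof -
  have "yc k v = zc k v \<or> yc k v + 1 \<le> zc k v \<or> zc k v + 1 \<le> yc k v"
    by linarith
  then have "real_of_int (yc k v) = zc k v \<or> real_of_int (yc k v) + 1 \<le> zc k v \<or> real_of_int (zc k v) + 1 \<le> yc k v"
    by linarith
  then show ?thesis
    by (cases "even k") (auto simp: one_gap_def profile_at_simps)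
qed

lemma cell_profile_at:
  assumes "sextant k v" "hex_norm v \<le> 2 * p - 1"
  shows "cell p (even k) (profile_at k v)"
proof -
  have "par v = 0 \<or> par v = 1" "xc k v + yc k v + zc k v = par v"
    "xc k v - yc k v \<le> height v" "xc k v - zc k v \<le> height v" "yc k v - xc k v \<le> height v" "zc k v - xc k v \<le> height v"
    "1 - p \<le> xc k v" "xc k v \<le> p - 1 + par v"
    using par_cases coord_sum[of k v] cube_diff_le_height cube_bound[OF assms(2)] by (auto simp: xc_def yc_def zc_def)
  then show ?thesis
    using assms(1)
    by (cases "even k") (auto simp: cell_def sextant_def profile_at_simps simp flip: of_int_add of_int_diff of_int_minus)
qed

lemma farc_pn: "farc p c u v \<longleftrightarrow> far_pn p (c u) (par u) (- c v) (par v)"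
  unfolding farc_def far_pn_def by linarith

lemma far1_profile_at:
  assumes "sextant k u" "sextant (Suc k) v" "2 * p < hex_dist u v" "hex_norm u \<le> 2 * p - 1" "hex_norm v \<le> 2 * p - 1"
  shows "far1 p (even k) (profile_at k u) (profile_at (Suc k) v)"
proof -
  \<comment> \<open>Neighbouring sextants differ only in the sign of \<open>yc k\<close>, so by
    \<open>farc_sign\<close> no other coordinate can separate the two vertices.\<close>
  have "if even k then farc p (yc k) v u else farc p (yc k) u v"
    by (rule far_cases[OF assms(3-5), of k]; use assms(1,2) in \<open>auto simp: sextant_def split: if_splits\<close>)
  then show ?thesis
    by (cases "even k") (auto simp: far1_def farc_pn profile_at_simps)
qed

lemma far2_profile_at:
  assumes "sextant k u" "sextant (Suc (Suc k)) v" "2 * p < hex_dist u v" "hex_norm u \<le> 2 * p - 1" "hex_norm v \<le> 2 * p - 1"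
  shows "far2 p (even k) (profile_at k u) (profile_at (Suc (Suc k)) v)"
proof -
  have "if even k then farc p (xc k) u v \<or> farc p (yc k) v u else farc p (xc k) v u \<or> farc p (yc k) u v"
    by (rule far_cases[OF assms(3-5), of k]; use assms(1,2) in \<open>auto simp: sextant_def split: if_splits\<close>)
  then show ?thesis
    by (cases "even k") (auto simp: far2_def farc_pn profile_at_simps)
qed

lemma far3_profile_at:
  assumes "sextant k u" "sextant (Suc (Suc (Suc k))) v" "2 * p < hex_dist u v" "hex_norm u \<le> 2 * p - 1" "hex_norm v \<le> 2 * p - 1"
  shows "far3 p (even k) (profile_at k u) (profile_at (Suc (Suc (Suc k))) v)"
proof -
  have "if even k then farc p (xc k) u v \<or> farc p (yc k) v u \<or> farc p (zc k) v u
    else farc p (xc k) v u \<or> farc p (yc k) u v \<or> farc p (zc k) u v"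
    by (rule far_cases[OF assms(3-5), of k]; use assms(1,2) in \<open>auto simp: sextant_def split: if_splits\<close>)
  \<comment> \<open>In opposite sextants the differences in \<open>yc k\<close> and
    \<open>zc k\<close> have the same sign, and by the coordinate sum the difference in
    \<open>xc k\<close> dominates both.\<close>
  then have "if even k then farc p (xc k) u v else farc p (xc k) v u"
    using assms(1,2) par_cases[of u] par_cases[of v] coord_sum[of k u] coord_sum[of k v]
    unfolding farc_def sextant_def coord_Suc even_Suc
    by (cases "even k"; simp only: simp_thms if_True if_False; linarith)
  then show ?thesis
    by (cases "even k") (auto simp: far3_def farc_pn profile_at_simps)
qed

lemma sextant_not_far:
  assumes "sextant k u" "sextant k v" "2 * p < hex_dist u v" "hex_norm u \<le> 2 * p - 1" "hex_norm v \<le> 2 * p - 1"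
  shows False
  by (rule far_cases[OF assms(3-5), of k]; use assms(1,2) in \<open>auto simp: sextant_def split: if_splits\<close>)

lemma sextant_periodic: "sextant (Suc (Suc (Suc (Suc (Suc (Suc k)))))) = sextant k"
  "profile_at (Suc (Suc (Suc (Suc (Suc (Suc k)))))) = profile_at k"
  by (auto simp: sextant_def profile_at_def fun_eq_iff)

lemma less_6: "k < 6 \<longleftrightarrow> k = 0 \<or> k = Suc 0 \<or> k = Suc (Suc 0) \<or> k = Suc (Suc (Suc 0)) \<or>
    k = Suc (Suc (Suc (Suc 0))) \<or> k = Suc (Suc (Suc (Suc (Suc 0))))" for k :: nat
  by linarith

lemma ex_sextant:
  assumes "v \<noteq> (0, 0)"
  shows "\<exists>k<6. sextant k v"
proof -
  have sum: "xc 0 v + yc 0 v + zc 0 v = par v" "0 \<le> par v" "par v \<le> 1"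
    using coord_sum[of 0 v] par_cases[of v] by auto
  have "\<not> (xc 0 v \<le> 0 \<and> yc 0 v \<le> 0 \<and> zc 0 v \<le> 0)"
  proof
    assume "xc 0 v \<le> 0 \<and> yc 0 v \<le> 0 \<and> zc 0 v \<le> 0"
    then have "xc 0 v = 0" "yc 0 v = 0" "zc 0 v = 0" "par v = 0"
      using sum by linarith+
    then have "fst v = 0" "snd v = 0"
      using cube_0[of v] cube_1[of v] by (auto simp: xc_def yc_def)
    with assms show False by (simp add: prod_eq_iff)
  qed
  moreover have "\<not> (1 \<le> xc 0 v \<and> 1 \<le> yc 0 v \<and> 1 \<le> zc 0 v)"
    using sum by linarith
  moreover have "1 \<le> x \<or> x \<le> 0" for x :: int
    by linarith
  ultimately have "sextant 0 v \<or> sextant (Suc 0) v \<or> sextant (Suc (Suc 0)) v \<or> sextant (Suc (Suc (Suc 0))) v \<or>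
    sextant (Suc (Suc (Suc (Suc 0)))) v \<or> sextant (Suc (Suc (Suc (Suc (Suc 0))))) v"
    by (simp add: sextant_def) blast
  then show ?thesis
    by (metis less_6)
qed

lemma sextant_unique: "sextant k v \<Longrightarrow> sextant l v \<Longrightarrow> k < 6 \<Longrightarrow> l < 6 \<Longrightarrow> k = l"
  unfolding less_6 by (elim disjE; simp add: sextant_def; linarith)

section \<open>The weights\<close>

text \<open>\<open>cap\<close> is the bound on the weight of a colour class and \<open>peak\<close>
  the apex of the tent, both doubled. With \<open>m = p div 2\<close>, \<open>cap\<close> is
  \<open>6 * m + 2\<close>, and \<open>peak\<close> is \<open>6 * m + 2\<close> or
  \<open>6 * m + 4\<close>.\<close>

definition cap :: "int \<Rightarrow> int" where "cap p = (if even p then 3 * p + 2 else 3 * p - 1)"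
definition peak :: "int \<Rightarrow> int" where "peak p = (if even p then 3 * p + 2 else 3 * p + 1)"
definition outer_radius :: "int \<Rightarrow> int" where "outer_radius p = p + 2 * (p div 2) - 1"

text \<open>For odd \<open>p\<close> opposite pairs need the correction. For even \<open>p\<close>
  parity settles those pairs, and only triples of alternate sextants need it; the axial vertices
  involved have height at least \<open>p + 1\<close>.\<close>

definition corrected :: "int \<Rightarrow> vert \<Rightarrow> bool" where
  "corrected p v \<longleftrightarrow> (\<exists>k. sextant k v \<and> axial (even k) (profile_at k v)) \<and> (odd p \<or> p + 1 \<le> height v)"

definition tent :: "int \<Rightarrow> vert \<Rightarrow> int" where
  "tent p v = peak p - 2 * height v - of_bool (corrected p v)"

text \<open>
  The first case affects only vertices that have no vertex of the region at distance more than \<open>2 * p\<close>.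
\<close>

definition weight :: "int \<Rightarrow> vert \<Rightarrow> int" where
  "weight p v = (if hex_norm v + outer_radius p \<le> 2 * p then cap p else max 0 (tent p v))"

text \<open>
  \<open>P k\<close> says that sextant \<open>k\<close> is occupied; up to rotation the listed patterns are all there are.
\<close>

lemma sum_six_le:
  fixes f :: "nat \<Rightarrow> int" and P :: "nat \<Rightarrow> bool"
  assumes per: "\<And>k. f (Suc (Suc (Suc (Suc (Suc (Suc k)))))) = f k" "\<And>k. P (Suc (Suc (Suc (Suc (Suc (Suc k)))))) = P k"
    and zero: "\<And>k. \<not> P k \<Longrightarrow> f k = 0"
    and b0: "0 \<le> W" and b1: "\<And>k. f k \<le> W"
    and b2: "\<And>k. P k \<Longrightarrow> P (Suc k) \<Longrightarrow> f k + f (Suc k) \<le> W"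
      "\<And>k. P k \<Longrightarrow> P (Suc (Suc k)) \<Longrightarrow> f k + f (Suc (Suc k)) \<le> W"
      "\<And>k. P k \<Longrightarrow> P (Suc (Suc (Suc k))) \<Longrightarrow> f k + f (Suc (Suc (Suc k))) \<le> W"
    and b3: "\<And>k. P k \<Longrightarrow> P (Suc k) \<Longrightarrow> P (Suc (Suc k)) \<Longrightarrow> f k + f (Suc k) + f (Suc (Suc k)) \<le> W"
      "\<And>k. P k \<Longrightarrow> P (Suc k) \<Longrightarrow> P (Suc (Suc (Suc k))) \<Longrightarrow> f k + f (Suc k) + f (Suc (Suc (Suc k))) \<le> W"
      "\<And>k. P k \<Longrightarrow> P (Suc (Suc k)) \<Longrightarrow> P (Suc (Suc (Suc k))) \<Longrightarrow> f k + f (Suc (Suc k)) + f (Suc (Suc (Suc k))) \<le> W"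
      "\<And>k. P k \<Longrightarrow> P (Suc (Suc k)) \<Longrightarrow> P (Suc (Suc (Suc (Suc k)))) \<Longrightarrow> f k + f (Suc (Suc k)) + f (Suc (Suc (Suc (Suc k)))) \<le> W"
    and b4: "\<And>k. P k \<Longrightarrow> P (Suc k) \<Longrightarrow> P (Suc (Suc k)) \<Longrightarrow> P (Suc (Suc (Suc k))) \<Longrightarrow>
        f k + f (Suc k) + f (Suc (Suc k)) + f (Suc (Suc (Suc k))) \<le> W"
      "\<And>k. P k \<Longrightarrow> P (Suc k) \<Longrightarrow> P (Suc (Suc k)) \<Longrightarrow> P (Suc (Suc (Suc (Suc k)))) \<Longrightarrow>
        f k + f (Suc k) + f (Suc (Suc k)) + f (Suc (Suc (Suc (Suc k)))) \<le> W"
      "\<And>k. P k \<Longrightarrow> P (Suc k) \<Longrightarrow> P (Suc (Suc (Suc k))) \<Longrightarrow> P (Suc (Suc (Suc (Suc k)))) \<Longrightarrow>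
        f k + f (Suc k) + f (Suc (Suc (Suc k))) + f (Suc (Suc (Suc (Suc k)))) \<le> W"
    and b5: "\<And>k. P k \<Longrightarrow> P (Suc k) \<Longrightarrow> P (Suc (Suc k)) \<Longrightarrow> P (Suc (Suc (Suc k))) \<Longrightarrow> P (Suc (Suc (Suc (Suc k)))) \<Longrightarrow>
        f k + f (Suc k) + f (Suc (Suc k)) + f (Suc (Suc (Suc k))) + f (Suc (Suc (Suc (Suc k)))) \<le> W"
    and b6: "\<And>k. P k \<Longrightarrow> P (Suc k) \<Longrightarrow> P (Suc (Suc k)) \<Longrightarrow> P (Suc (Suc (Suc k))) \<Longrightarrow> P (Suc (Suc (Suc (Suc k)))) \<Longrightarrow>
        P (Suc (Suc (Suc (Suc (Suc k))))) \<Longrightarrow>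
        f k + f (Suc k) + f (Suc (Suc k)) + f (Suc (Suc (Suc k))) + f (Suc (Suc (Suc (Suc k)))) + f (Suc (Suc (Suc (Suc (Suc k))))) \<le> W"
  shows "(\<Sum>k<6. f k) \<le> W"
proof -
  let ?s = "Suc :: nat \<Rightarrow> nat"
  have sum: "(\<Sum>k<6. f k) = f 0 + f (?s 0) + f (?s (?s 0)) + f (?s (?s (?s 0))) + f (?s (?s (?s (?s 0)))) +
      f (?s (?s (?s (?s (?s 0)))))"
    by (simp add: eval_nat_numeral)
  \<comment> \<open>The bounds for two to five sextants are taken at all six rotations, so that each
    of the 64 sets of occupied sextants matches one of them after the indices are reduced by
    \<open>per\<close>.\<close>
  note rotations =
    b2[of "0"] b3[of "0"] b4[of "0"] b5[of "0"]
    b2[of "?s 0"] b3[of "?s 0"] b4[of "?s 0"] b5[of "?s 0"]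
    b2[of "?s (?s 0)"] b3[of "?s (?s 0)"] b4[of "?s (?s 0)"] b5[of "?s (?s 0)"]
    b2[of "?s (?s (?s 0))"] b3[of "?s (?s (?s 0))"] b4[of "?s (?s (?s 0))"] b5[of "?s (?s (?s 0))"]
    b2[of "?s (?s (?s (?s 0)))"] b3[of "?s (?s (?s (?s 0)))"] b4[of "?s (?s (?s (?s 0)))"] b5[of "?s (?s (?s (?s 0)))"]
    b2[of "?s (?s (?s (?s (?s 0))))"] b3[of "?s (?s (?s (?s (?s 0))))"] b4[of "?s (?s (?s (?s (?s 0))))"] b5[of "?s (?s (?s (?s (?s 0))))"] b6[of 0]
  note rotations = rotations[simplified per ac_simps]
  show ?thesis
    unfolding sum
    by (cases "P 0"; cases "P (?s 0)"; cases "P (?s (?s 0))"; cases "P (?s (?s (?s 0)))";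
        cases "P (?s (?s (?s (?s 0))))"; cases "P (?s (?s (?s (?s (?s 0)))))")
      (simp_all add: zero per b0 b1 rotations ac_simps)
qed

lemma tent_corrected:
  assumes "sextant k v" "axial e (profile_at k v)" "e = even k" "odd p \<or> p + 1 \<le> height v"
  shows "tent p v = peak p - 2 * height v - 1"
  using assms by (auto simp: tent_def corrected_def)

lemma tent_le: "tent p v \<le> peak p - 2 * height v"
  by (simp add: tent_def)

section \<open>The weight of a colour class\<close>

text \<open>\<open>J\<close> models the positive-weight part of a colour class with at least two
  vertices, where the weight is just the tent value.\<close>

locale far_set =
  fixes p :: int and J :: "vert set"
  assumes finite_J: "finite J"
    and hex_norm_J: "v \<in> J \<Longrightarrow> hex_norm v \<le> 2 * p - 1"
    and far_J: "u \<in> J \<Longrightarrow> v \<in> J \<Longrightarrow> u \<noteq> v \<Longrightarrow> 2 * p < hex_dist u v"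
    and origin_J: "(0, 0) \<notin> J"
    and pos_J: "1 \<le> p"
    and tent_J: "v \<in> J \<Longrightarrow> tent p v \<le> cap p"
begin

definition sector :: "nat \<Rightarrow> vert set" where
  "sector k = {v \<in> J. sextant k v}"

lemma sec_cell: "v \<in> sector k \<Longrightarrow> even k \<longleftrightarrow> e \<Longrightarrow> cell p e (profile_at k v)"
  unfolding sector_def using cell_profile_at[of k v p] hex_norm_J[of v] by blast

lemma sec_far1: "u \<in> sector k \<Longrightarrow> v \<in> sector (Suc k) \<Longrightarrow> even k \<longleftrightarrow> e \<Longrightarrow> far1 p e (profile_at k u) (profile_at (Suc k) v)"
proof -
  assume *: "u \<in> sector k" "v \<in> sector (Suc k)" "even k \<longleftrightarrow> e"
  then have "u \<noteq> v" by (cases e) (auto simp: sector_def sextant_def)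
  with * show ?thesis by (auto simp: sector_def intro!: far1_profile_at hex_norm_J far_J)
qed

lemma sec_far2:
  "u \<in> sector k \<Longrightarrow> v \<in> sector (Suc (Suc k)) \<Longrightarrow> even k \<longleftrightarrow> e \<Longrightarrow> far2 p e (profile_at k u) (profile_at (Suc (Suc k)) v)"
proof -
  assume *: "u \<in> sector k" "v \<in> sector (Suc (Suc k))" "even k \<longleftrightarrow> e"
  then have "u \<noteq> v" by (cases e) (auto simp: sector_def sextant_def)
  with * show ?thesis by (auto simp: sector_def intro!: far2_profile_at hex_norm_J far_J)
qed

lemma sec_far3:
  "u \<in> sector k \<Longrightarrow> v \<in> sector (Suc (Suc (Suc k))) \<Longrightarrow> even k \<longleftrightarrow> e \<Longrightarrow>
    far3 p e (profile_at k u) (profile_at (Suc (Suc (Suc k))) v)"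
proof -
  assume *: "u \<in> sector k" "v \<in> sector (Suc (Suc (Suc k)))" "even k \<longleftrightarrow> e"
  then have "u \<noteq> v" by (cases e) (auto simp: sector_def sextant_def)
  with * show ?thesis by (auto simp: sector_def intro!: far3_profile_at hex_norm_J far_J)
qed

lemma sec_periodic: "sector (Suc (Suc (Suc (Suc (Suc (Suc k)))))) = sector k"
  by (simp add: sector_def sextant_periodic)

lemma sec_far2_wrap:
  "u \<in> sector (Suc (Suc (Suc (Suc k)))) \<Longrightarrow> v \<in> sector k \<Longrightarrow> even k \<longleftrightarrow> e \<Longrightarrow>
    far2 p e (profile_at (Suc (Suc (Suc (Suc k)))) u) (profile_at k v)"
  using sec_far2[of u "Suc (Suc (Suc (Suc k)))" v] by (simp add: sec_periodic sextant_periodic)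

lemma sec_far1_wrap:
  "u \<in> sector (Suc (Suc (Suc (Suc (Suc k))))) \<Longrightarrow> v \<in> sector k \<Longrightarrow> odd k \<longleftrightarrow> e \<Longrightarrow>
    far1 p e (profile_at (Suc (Suc (Suc (Suc (Suc k))))) u) (profile_at k v)"
  using sec_far1[of u "Suc (Suc (Suc (Suc (Suc k))))" v] by (simp add: sec_periodic sextant_periodic)

lemmas sec_facts = sec_cell sec_far1 sec_far2 sec_far3 sec_far2_wrap sec_far1_wrap one_gap_profile_at

lemma sec_single: "u \<in> sector k \<Longrightarrow> v \<in> sector k \<Longrightarrow> u = v"
  using sextant_not_far hex_norm_J far_J unfolding sector_def by blast

definition sector_tent :: "nat \<Rightarrow> int" where
  "sector_tent k = (\<Sum>v\<in>sector k. tent p v)"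

lemma sector_tent_eq: "v \<in> sector k \<Longrightarrow> sector_tent k = tent p v"
proof -
  assume "v \<in> sector k"
  then have "sector k = {v}" using sec_single by blast
  then show ?thesis by (simp add: sector_tent_def)
qed

section \<open>Tent sums over the patterns of occupied sextants\<close>

lemma pair_bound:
  assumes "real_of_int (3 * p + 2) \<le> real_of_int (2 * (height u + height v))"
  shows "tent p u + tent p v \<le> cap p"
proof -
  have *: "3 * p + 2 \<le> 2 * (height u + height v)"
    using assms by (simp only: of_int_le_iff)
  show ?thesis
  proof (cases "even p")
    case True
    with * tent_le[of p u] tent_le[of p v] show ?thesis by (simp add: cap_def peak_def)
  next
    case False
    \<comment> \<open>For odd \<open>p\<close> the left side is odd, which yields the missing
      unit.\<close>
    then have "3 * p + 2 \<noteq> 2 * (height u + height v)" by presburger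
    with False * tent_le[of p u] tent_le[of p v] show ?thesis by (simp add: cap_def peak_def)
  qed
qed

lemma sec_pair1: "u \<in> sector k \<Longrightarrow> v \<in> sector (Suc k) \<Longrightarrow> tent p u + tent p v \<le> cap p"
  using pair1[of p "even k" "profile_at k u" "profile_at (Suc k) v"]
  by (intro pair_bound) (simp add: profile_at_simps sec_facts)

lemma sec_pair2: "u \<in> sector k \<Longrightarrow> v \<in> sector (Suc (Suc k)) \<Longrightarrow> tent p u + tent p v \<le> cap p"
  using pair2[of p "even k" "profile_at k u" "profile_at (Suc (Suc k)) v"]
  by (intro pair_bound) (simp add: profile_at_simps sec_facts)

text \<open>If \<open>pair_bound\<close> does not apply, twice the heights sum to exactly
  \<open>3 * p + 1\<close>, so \<open>p\<close> is odd and both vertices are axial; their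
  corrections remove the two excess units.\<close>

lemma sec_pair3:
  assumes u: "u \<in> sector k" and v: "v \<in> sector (Suc (Suc (Suc k)))"
  shows "tent p u + tent p v \<le> cap p"
proof (cases "real_of_int (3 * p + 2) \<le> real_of_int (2 * (height u + height v))")
  case False
  have c: "cell p (even k) (profile_at k u)" "cell p (\<not> even k) (profile_at (Suc (Suc (Suc k))) v)"
    "far3 p (even k) (profile_at k u) (profile_at (Suc (Suc (Suc k))) v)"
    using u v by (simp_all add: sec_facts)
  have "real_of_int (3 * p + 1) \<le> real_of_int (2 * (height u + height v))"
    using pair3[OF c] by (simp add: profile_at_simps)
  then have eq: "3 * p + 1 = 2 * (height u + height v)"
    using False unfolding of_int_le_iff by linarith
  then have "odd p" by presburger
  have ax: "axial (even k) (profile_at k u)" "axial (\<not> even k) (profile_at (Suc (Suc (Suc k))) v)"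
    using pair3_tight[OF c one_gap_profile_at one_gap_profile_at] False by (auto simp: profile_at_simps)
  have "tent p u = peak p - 2 * height u - 1" "tent p v = peak p - 2 * height v - 1"
    using u v \<open>odd p\<close> by (auto simp: sector_def intro!: tent_corrected[OF _ ax(1)] tent_corrected[OF _ ax(2)])
  then show ?thesis
    using eq \<open>odd p\<close> by (simp add: cap_def peak_def)
qed (rule pair_bound)

lemma triple_bound:
  assumes "real_of_int (3 * p + 2) \<le> real_of_int (height u + height v + height w)"
  shows "tent p u + tent p v + tent p w \<le> cap p"
proof -
  have "3 * p + 2 \<le> height u + height v + height w"
    using assms by (simp only: of_int_le_iff)
  then show ?thesis
    using tent_le[of p u] tent_le[of p v] tent_le[of p w] by (auto simp: cap_def peak_def)
qed

lemma sec_triple012: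
  "u \<in> sector k \<Longrightarrow> v \<in> sector (Suc k) \<Longrightarrow> w \<in> sector (Suc (Suc k)) \<Longrightarrow> tent p u + tent p v + tent p w \<le> cap p"
  using triple012[of p "even k" "profile_at k u" "profile_at (Suc k) v" "profile_at (Suc (Suc k)) w"]
  by (intro triple_bound) (simp add: profile_at_simps sec_facts)

lemma sec_triple013:
  "u \<in> sector k \<Longrightarrow> v \<in> sector (Suc k) \<Longrightarrow> w \<in> sector (Suc (Suc (Suc k))) \<Longrightarrow>
    tent p u + tent p v + tent p w \<le> cap p"
  using triple013[of p "even k" "profile_at k u" "profile_at (Suc k) v" "profile_at (Suc (Suc (Suc k))) w"]
  by (intro triple_bound) (simp add: profile_at_simps sec_facts)

lemma sec_triple023:
  "u \<in> sector k \<Longrightarrow> v \<in> sector (Suc (Suc k)) \<Longrightarrow> w \<in> sector (Suc (Suc (Suc k))) \<Longrightarrow>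
    tent p u + tent p v + tent p w \<le> cap p"
  using triple023[of p "even k" "profile_at k u" "profile_at (Suc (Suc k)) v" "profile_at (Suc (Suc (Suc k))) w"]
  by (intro triple_bound) (simp add: profile_at_simps sec_facts)

text \<open>Heights summing to \<open>3 * p + 1\<close> leave the tent sum two units above
  \<open>cap p\<close>. Two of the vertices are then axial and of height at least
  \<open>p + 1\<close>, and each loses one unit.\<close>

lemma sec_triple024:
  assumes u: "u \<in> sector k" and v: "v \<in> sector (Suc (Suc k))" and w: "w \<in> sector (Suc (Suc (Suc (Suc k))))"
  shows "tent p u + tent p v + tent p w \<le> cap p"
proof (cases "real_of_int (3 * p + 2) \<le> real_of_int (height u + height v + height w)")
  case False
  have c: "cell p (even k) (profile_at k u)" "cell p (even k) (profile_at (Suc (Suc k)) v)"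
    "cell p (even k) (profile_at (Suc (Suc (Suc (Suc k)))) w)"
    "far2 p (even k) (profile_at k u) (profile_at (Suc (Suc k)) v)"
    "far2 p (even k) (profile_at (Suc (Suc k)) v) (profile_at (Suc (Suc (Suc (Suc k)))) w)"
    "far2 p (even k) (profile_at (Suc (Suc (Suc (Suc k)))) w) (profile_at k u)"
    using u v w by (simp_all add: sec_facts)
  have "real_of_int (3 * p) < real_of_int (height u + height v + height w)"
    using triple024[OF c] by (simp add: profile_at_simps)
  then have eq: "height u + height v + height w = 3 * p + 1"
    using False unfolding of_int_le_iff of_int_less_iff by linarith
  have "real_of_int (height u + height v + height w) \<le> real_of_int (3 * p + 1)"
    unfolding eq ..
  then have "pheight (profile_at k u) + pheight (profile_at (Suc (Suc k)) v) + pheight (profile_at (Suc (Suc (Suc (Suc k)))) w) \<le> 3 * real_of_int p + 1"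
    by (simp add: profile_at_simps)
  note ax = triple024_tight[OF c one_gap_profile_at one_gap_profile_at one_gap_profile_at this]
  have thr: "p + 1 \<le> height z" if "real_of_int p + 1 \<le> pheight (profile_at j z)" for j z
  proof -
    have "real_of_int (p + 1) \<le> real_of_int (height z)"
      using that by (simp add: profile_at_simps)
    then show ?thesis by (simp only: of_int_le_iff)
  qed
  have sx: "sextant k u" "sextant (Suc (Suc k)) v" "sextant (Suc (Suc (Suc (Suc k)))) w"
    using u v w by (simp_all add: sector_def)
  have corr_u: "tent p u = peak p - 2 * height u - 1" if "axial (even k) (profile_at k u)" "real_of_int p + 1 \<le> pheight (profile_at k u)"
    by (rule tent_corrected[OF sx(1) that(1)]) (use thr[OF that(2)] in auto)
  have corr_v: "tent p v = peak p - 2 * height v - 1"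
    if "axial (even k) (profile_at (Suc (Suc k)) v)" "real_of_int p + 1 \<le> pheight (profile_at (Suc (Suc k)) v)"
    by (rule tent_corrected[OF sx(2) that(1)]) (use thr[OF that(2)] in auto)
  have corr_w: "tent p w = peak p - 2 * height w - 1"
    if "axial (even k) (profile_at (Suc (Suc (Suc (Suc k)))) w)" "real_of_int p + 1 \<le> pheight (profile_at (Suc (Suc (Suc (Suc k)))) w)"
    by (rule tent_corrected[OF sx(3) that(1)]) (use thr[OF that(2)] in auto)
  from ax have "tent p u + tent p v + tent p w \<le> 3 * peak p - 2 * (height u + height v + height w) - 2"
  proof (elim disjE conjE)
    assume "axial (even k) (profile_at k u)" "real_of_int p + 1 \<le> pheight (profile_at k u)"
      "axial (even k) (profile_at (Suc (Suc k)) v)" "real_of_int p + 1 \<le> pheight (profile_at (Suc (Suc k)) v)"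
    from corr_u[OF this(1,2)] corr_v[OF this(3,4)] show ?thesis using tent_le[of p w] by simp
  next
    assume "axial (even k) (profile_at (Suc (Suc k)) v)" "real_of_int p + 1 \<le> pheight (profile_at (Suc (Suc k)) v)"
      "axial (even k) (profile_at (Suc (Suc (Suc (Suc k)))) w)" "real_of_int p + 1 \<le> pheight (profile_at (Suc (Suc (Suc (Suc k)))) w)"
    from corr_v[OF this(1,2)] corr_w[OF this(3,4)] show ?thesis using tent_le[of p u] by simp
  next
    assume "axial (even k) (profile_at (Suc (Suc (Suc (Suc k)))) w)" "real_of_int p + 1 \<le> pheight (profile_at (Suc (Suc (Suc (Suc k)))) w)"
      "axial (even k) (profile_at k u)" "real_of_int p + 1 \<le> pheight (profile_at k u)"
    from corr_w[OF this(1,2)] corr_u[OF this(3,4)] show ?thesis using tent_le[of p v] by simp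
  qed
  then show ?thesis
    unfolding eq by (auto simp: cap_def peak_def split: if_splits)
qed (rule triple_bound)

lemma quad_bound:
  assumes "real_of_int (9 * p + 5) \<le> real_of_int (2 * (height u + height v + height w + height z))"
  shows "tent p u + tent p v + tent p w + tent p z \<le> cap p"
proof -
  have *: "9 * p + 5 \<le> 2 * (height u + height v + height w + height z)"
    using assms by (simp only: of_int_le_iff)
  show ?thesis
  proof (cases "even p")
    case True
    \<comment> \<open>For even \<open>p\<close> the left side is odd, so the bound improves to
      \<open>9 * p + 6\<close>.\<close>
    then have "9 * p + 5 \<noteq> 2 * (height u + height v + height w + height z)" by presburger
    with True * tent_le[of p u] tent_le[of p v] tent_le[of p w] tent_le[of p z] show ?thesis
      by (simp add: cap_def peak_def)
  next
    case False
    with * tent_le[of p u] tent_le[of p v] tent_le[of p w] tent_le[of p z] show ?thesis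
      by (simp add: cap_def peak_def)
  qed
qed

lemma sec_quad0123:
  "u \<in> sector k \<Longrightarrow> v \<in> sector (Suc k) \<Longrightarrow> w \<in> sector (Suc (Suc k)) \<Longrightarrow> z \<in> sector (Suc (Suc (Suc k))) \<Longrightarrow>
    tent p u + tent p v + tent p w + tent p z \<le> cap p"
  using quad0123[of p "even k" "profile_at k u" "profile_at (Suc k) v" "profile_at (Suc (Suc k)) w" "profile_at (Suc (Suc (Suc k))) z"]
  by (intro quad_bound) (simp add: profile_at_simps sec_facts)

lemma sec_quad0124:
  "u \<in> sector k \<Longrightarrow> v \<in> sector (Suc k) \<Longrightarrow> w \<in> sector (Suc (Suc k)) \<Longrightarrow> z \<in> sector (Suc (Suc (Suc (Suc k)))) \<Longrightarrow>
    tent p u + tent p v + tent p w + tent p z \<le> cap p"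
  using quad0124[of p "even k" "profile_at k u" "profile_at (Suc k) v" "profile_at (Suc (Suc k)) w" "profile_at (Suc (Suc (Suc (Suc k)))) z"]
  by (intro quad_bound) (simp add: profile_at_simps sec_facts)

lemma sec_quad0134:
  "u \<in> sector k \<Longrightarrow> v \<in> sector (Suc k) \<Longrightarrow> w \<in> sector (Suc (Suc (Suc k))) \<Longrightarrow> z \<in> sector (Suc (Suc (Suc (Suc k)))) \<Longrightarrow>
    tent p u + tent p v + tent p w + tent p z \<le> cap p"
  using quad0134[of p "even k" "profile_at k u" "profile_at (Suc k) v" "profile_at (Suc (Suc (Suc k))) w"
      "profile_at (Suc (Suc (Suc (Suc k)))) z"]
  by (intro quad_bound) (simp add: profile_at_simps sec_facts)

lemma sec_quint:
  assumes u: "u \<in> sector k" and v: "v \<in> sector (Suc k)" and w: "w \<in> sector (Suc (Suc k))"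
    and z: "z \<in> sector (Suc (Suc (Suc k)))" and t: "t \<in> sector (Suc (Suc (Suc (Suc k))))"
  shows "tent p u + tent p v + tent p w + tent p z + tent p t \<le> cap p"
proof -
  have "real_of_int (6 * p + 4) \<le> real_of_int (height u + height v + height w + height z + height t)"
    using quint01234[of p "even k" "profile_at k u" "profile_at (Suc k) v" "profile_at (Suc (Suc k)) w" "profile_at (Suc (Suc (Suc k))) z"
        "profile_at (Suc (Suc (Suc (Suc k)))) t"] assms
    by (simp add: profile_at_simps sec_facts)
  then have "6 * p + 4 \<le> height u + height v + height w + height z + height t"
    by (simp only: of_int_le_iff)
  then show ?thesis
    using tent_le[of p u] tent_le[of p v] tent_le[of p w] tent_le[of p z] tent_le[of p t]
    by (auto simp: cap_def peak_def split: if_splits)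
qed

lemma sec_sext:
  assumes u: "u \<in> sector k" and v: "v \<in> sector (Suc k)" and w: "w \<in> sector (Suc (Suc k))"
    and z: "z \<in> sector (Suc (Suc (Suc k)))" and t: "t \<in> sector (Suc (Suc (Suc (Suc k))))"
    and s: "s \<in> sector (Suc (Suc (Suc (Suc (Suc k)))))"
  shows "tent p u + tent p v + tent p w + tent p z + tent p t + tent p s \<le> cap p"
proof -
  have "real_of_int (15 * p + 10) \<le> real_of_int (2 * (height u + height v + height w + height z + height t + height s))"
    using sext012345[of p "even k" "profile_at k u" "profile_at (Suc k) v" "profile_at (Suc (Suc k)) w" "profile_at (Suc (Suc (Suc k))) z"
        "profile_at (Suc (Suc (Suc (Suc k)))) t" "profile_at (Suc (Suc (Suc (Suc (Suc k))))) s"] assms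
    by (simp add: profile_at_simps sec_facts)
  then have "15 * p + 10 \<le> 2 * (height u + height v + height w + height z + height t + height s)"
    by (simp only: of_int_le_iff)
  then show ?thesis
    using tent_le[of p u] tent_le[of p v] tent_le[of p w] tent_le[of p z] tent_le[of p t] tent_le[of p s] pos_J
    by (auto simp: cap_def peak_def split: if_splits)
qed

lemma sum_tent_le: "(\<Sum>v\<in>J. tent p v) \<le> cap p"
proof -
  have "\<exists>k<6. sextant k v" if "v \<in> J" for v
    using ex_sextant[of v] origin_J that by metis
  then have "J = (\<Union>k\<in>{..<6}. sector k)"
    unfolding sector_def by blast
  moreover have "sector k \<inter> sector l = {}" if "k < 6" "l < 6" "k \<noteq> l" for k l
    using sextant_unique that by (auto simp: sector_def)
  ultimately have "(\<Sum>v\<in>J. tent p v) = (\<Sum>k<6. sector_tent k)"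
    unfolding sector_tent_def using finite_J
    by (subst sum.UNION_disjoint[symmetric]) (auto simp: sector_def)
  also have "\<dots> \<le> cap p"
  proof (rule sum_six_le[where P = "\<lambda>k. \<exists>v. v \<in> sector k"])
    show "sector_tent (Suc (Suc (Suc (Suc (Suc (Suc k)))))) = sector_tent k" for k
      by (simp add: sector_tent_def sec_periodic)
    show "(\<exists>v. v \<in> sector (Suc (Suc (Suc (Suc (Suc (Suc k))))))) = (\<exists>v. v \<in> sector k)" for k
      by (simp add: sec_periodic)
    show zero: "sector_tent k = 0" if "\<not> (\<exists>v. v \<in> sector k)" for k
    proof -
      have "sector k = {}" using that by blast
      then show ?thesis by (simp add: sector_tent_def)
    qed
    show cap: "0 \<le> cap p"
      using pos_J by (simp add: cap_def)
    show "sector_tent k \<le> cap p" for k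
    proof (cases "\<exists>v. v \<in> sector k")
      case True
      then obtain v where "v \<in> sector k" by blast
      then show ?thesis using tent_J[of v] sector_tent_eq[of v k] by (simp add: sector_def)
    qed (simp add: zero cap)
    show "sector_tent k + sector_tent (Suc k) \<le> cap p"
      if "\<exists>v. v \<in> sector k" "\<exists>v. v \<in> sector (Suc k)" for k
      using that sec_pair1 sector_tent_eq by metis
    show "sector_tent k + sector_tent (Suc (Suc k)) \<le> cap p"
      if "\<exists>v. v \<in> sector k" "\<exists>v. v \<in> sector (Suc (Suc k))" for k
      using that sec_pair2 sector_tent_eq by metis
    show "sector_tent k + sector_tent (Suc (Suc (Suc k))) \<le> cap p"
      if "\<exists>v. v \<in> sector k" "\<exists>v. v \<in> sector (Suc (Suc (Suc k)))" for k
      using that sec_pair3 sector_tent_eq by metis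
    show "sector_tent k + sector_tent (Suc k) + sector_tent (Suc (Suc k)) \<le> cap p"
      if "\<exists>v. v \<in> sector k" "\<exists>v. v \<in> sector (Suc k)" "\<exists>v. v \<in> sector (Suc (Suc k))" for k
      using that sec_triple012 sector_tent_eq by metis
    show "sector_tent k + sector_tent (Suc k) + sector_tent (Suc (Suc (Suc k))) \<le> cap p"
      if "\<exists>v. v \<in> sector k" "\<exists>v. v \<in> sector (Suc k)" "\<exists>v. v \<in> sector (Suc (Suc (Suc k)))" for k
      using that sec_triple013 sector_tent_eq by metis
    show "sector_tent k + sector_tent (Suc (Suc k)) + sector_tent (Suc (Suc (Suc k))) \<le> cap p"
      if "\<exists>v. v \<in> sector k" "\<exists>v. v \<in> sector (Suc (Suc k))" "\<exists>v. v \<in> sector (Suc (Suc (Suc k)))" for k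
      using that sec_triple023 sector_tent_eq by metis
    show "sector_tent k + sector_tent (Suc (Suc k)) + sector_tent (Suc (Suc (Suc (Suc k)))) \<le> cap p"
      if "\<exists>v. v \<in> sector k" "\<exists>v. v \<in> sector (Suc (Suc k))" "\<exists>v. v \<in> sector (Suc (Suc (Suc (Suc k))))" for k
      using that sec_triple024 sector_tent_eq by metis
    show "sector_tent k + sector_tent (Suc k) + sector_tent (Suc (Suc k)) + sector_tent (Suc (Suc (Suc k))) \<le> cap p"
      if "\<exists>v. v \<in> sector k" "\<exists>v. v \<in> sector (Suc k)" "\<exists>v. v \<in> sector (Suc (Suc k))" "\<exists>v. v \<in> sector (Suc (Suc (Suc k)))" for k
      using that sec_quad0123 sector_tent_eq by metis
    show "sector_tent k + sector_tent (Suc k) + sector_tent (Suc (Suc k)) + sector_tent (Suc (Suc (Suc (Suc k)))) \<le> cap p"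
      if "\<exists>v. v \<in> sector k" "\<exists>v. v \<in> sector (Suc k)" "\<exists>v. v \<in> sector (Suc (Suc k))" "\<exists>v. v \<in> sector (Suc (Suc (Suc (Suc k))))" for k
      using that sec_quad0124 sector_tent_eq by metis
    show "sector_tent k + sector_tent (Suc k) + sector_tent (Suc (Suc (Suc k))) + sector_tent (Suc (Suc (Suc (Suc k)))) \<le> cap p"
      if "\<exists>v. v \<in> sector k" "\<exists>v. v \<in> sector (Suc k)" "\<exists>v. v \<in> sector (Suc (Suc (Suc k)))" "\<exists>v. v \<in> sector (Suc (Suc (Suc (Suc k))))" for k
      using that sec_quad0134 sector_tent_eq by metis
    show "sector_tent k + sector_tent (Suc k) + sector_tent (Suc (Suc k)) + sector_tent (Suc (Suc (Suc k))) + sector_tent (Suc (Suc (Suc (Suc k)))) \<le> cap p"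
      if "\<exists>v. v \<in> sector k" "\<exists>v. v \<in> sector (Suc k)" "\<exists>v. v \<in> sector (Suc (Suc k))" "\<exists>v. v \<in> sector (Suc (Suc (Suc k)))" "\<exists>v. v \<in> sector (Suc (Suc (Suc (Suc k))))" for k
      using that sec_quint sector_tent_eq by metis
    show "sector_tent k + sector_tent (Suc k) + sector_tent (Suc (Suc k)) + sector_tent (Suc (Suc (Suc k))) + sector_tent (Suc (Suc (Suc (Suc k)))) + sector_tent (Suc (Suc (Suc (Suc (Suc k))))) \<le> cap p"
      if "\<exists>v. v \<in> sector k" "\<exists>v. v \<in> sector (Suc k)" "\<exists>v. v \<in> sector (Suc (Suc k))" "\<exists>v. v \<in> sector (Suc (Suc (Suc k)))" "\<exists>v. v \<in> sector (Suc (Suc (Suc (Suc k))))" "\<exists>v. v \<in> sector (Suc (Suc (Suc (Suc (Suc k)))))" for k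
      using that sec_sext sector_tent_eq by metis
  qed
  finally show ?thesis .
qed

end

section \<open>From tent values to weights\<close>

lemma outer_radius_le: "outer_radius p \<le> 2 * p - 1"
  by (simp add: outer_radius_def)

lemma height_nonneg: "0 \<le> height v"
  using height_ge(1)[of v] by linarith

lemma height_pos: "v \<noteq> (0, 0) \<Longrightarrow> 1 \<le> height v"
proof (rule ccontr)
  assume "v \<noteq> (0, 0)" "\<not> 1 \<le> height v"
  then have "snd v = 0" "\<bar>3 * fst v - par v\<bar> \<le> 0"
    using height_ge[of v] by linarith+
  then have "fst v = 0"
    using par_cases[of v] by presburger
  with \<open>snd v = 0\<close> \<open>v \<noteq> (0, 0)\<close> show False by (simp add: prod_eq_iff)
qed

lemma weight_nonneg: "1 \<le> p \<Longrightarrow> 0 \<le> weight p v"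
  by (simp add: weight_def cap_def)

lemma tent_le_cap: "1 \<le> p \<Longrightarrow> v \<noteq> (0, 0) \<Longrightarrow> tent p v \<le> cap p"
  using height_pos[of v] tent_le[of p v] by (auto simp: cap_def peak_def split: if_splits)

lemma weight_le_cap:
  assumes "1 \<le> p"
  shows "weight p v \<le> cap p"
proof (cases "hex_norm v + outer_radius p \<le> 2 * p")
  case False
  then have "v \<noteq> (0, 0)"
    using outer_radius_le[of p] by auto
  with assms show ?thesis
    using tent_le_cap[of p v] by (simp add: weight_def) (simp add: cap_def)
qed (simp add: weight_def)

text \<open>If two vertices of positive weight occur, the triangle inequality through the origin
  shows that none has a raised weight, and the tent bound applies. Otherwise
  \<open>weight_le_cap\<close> suffices.\<close>

lemma sum_weight_le:
  assumes p: "1 \<le> p" and I: "finite I" "\<And>v. v \<in> I \<Longrightarrow> hex_norm v \<le> outer_radius p"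
    and far: "\<And>u v. u \<in> I \<Longrightarrow> v \<in> I \<Longrightarrow> u \<noteq> v \<Longrightarrow> 2 * p < hex_dist u v"
  shows "(\<Sum>v\<in>I. weight p v) \<le> cap p"
proof -
  define J where "J = {v \<in> I. 0 < weight p v}"
  have "(\<Sum>v\<in>I. weight p v) = (\<Sum>v\<in>J. weight p v)"
    unfolding J_def using I(1) weight_nonneg[OF p] by (intro sum.mono_neutral_right) (auto simp: order.order_iff_strict)
  also have "\<dots> \<le> cap p"
  proof (cases "\<exists>u\<in>J. \<exists>v\<in>J. u \<noteq> v")
    case True
    then have other: "\<exists>u\<in>J. u \<noteq> v" for v by metis
    have noncentral: "2 * p < hex_norm v + outer_radius p" if v: "v \<in> J" for v
    proof -
      obtain u where "u \<in> J" "u \<noteq> v" using other by blast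
      with v show ?thesis
        using far[of v u] I(2)[of u] hex_dist_triangle[of v u] by (auto simp: J_def)
    qed
    have origin: "(0, 0) \<notin> J"
      using noncentral[of "(0, 0)"] outer_radius_le[of p] by auto
    interpret far_set p J
    proof
      show "finite J" using I(1) by (simp add: J_def)
      show "hex_norm v \<le> 2 * p - 1" if "v \<in> J" for v
        using that I(2)[of v] outer_radius_le[of p] by (simp add: J_def)
      show "2 * p < hex_dist u v" if "u \<in> J" "v \<in> J" "u \<noteq> v" for u v
        using that far by (simp add: J_def)
      show "tent p v \<le> cap p" if "v \<in> J" for v
        using that origin tent_le_cap[OF p] by metis
    qed (use origin p in auto)
    have "weight p v = tent p v" if "v \<in> J" for v
      using noncentral[OF that] that by (auto simp: J_def weight_def)
    then show ?thesis
      using sum_tent_le by simp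
  next
    case False
    then have "J = {} \<or> (\<exists>v. J = {v})" by blast
    then show ?thesis
      using weight_le_cap[OF p] p by (auto simp: cap_def)
  qed
  finally show ?thesis .
qed

section \<open>The total weight\<close>

lemma sum_symmetric:
  fixes h :: "int \<Rightarrow> int"
  shows "(\<Sum>j\<in>{- int (Suc k)..int (Suc k)}. h \<bar>j\<bar>) = (\<Sum>j\<in>{- int k..int k}. h \<bar>j\<bar>) + 2 * h (int (Suc k))"
proof -
  have "{- int (Suc k)..int (Suc k)} = insert (- int (Suc k)) (insert (int (Suc k)) {- int k..int k})"
    by auto
  then show ?thesis by (simp add: add.commute)
qed

text \<open>Put \<open>L = 2 * k - \<bar>j\<bar>\<close>, which has the parity of \<open>j\<close>.
  Then \<open>3 * i = L + 1\<close> forces type 1 and \<open>- (3 * i) = L\<close> forces type 0, so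
  the type drops out of both bounds on \<open>i\<close>.\<close>

lemma row_iff:
  "height (i, j) \<le> k \<longleftrightarrow> \<bar>j\<bar> \<le> k \<and> - ((2 * k - \<bar>j\<bar>) div 3) \<le> i \<and> i \<le> (2 * k - \<bar>j\<bar> + 1) div 3"
proof -
  obtain q where q: "par (i, j) = i + j - 2 * q"
    using par_half[of "(i, j)"] by auto
  define L where "L = 2 * k - \<bar>j\<bar>"
  obtain r where r: "L = 2 * r + j"
  proof (cases "0 \<le> j")
    case True
    then show ?thesis using that[of "k - j"] by (simp add: L_def)
  next
    case False
    then show ?thesis using that[of k] by (simp add: L_def)
  qed
  have "3 * i - par (i, j) \<le> L \<longleftrightarrow> 3 * i \<le> L + 1"
    using par_cases[of "(i, j)"] q r by presburger
  moreover have "par (i, j) - 3 * i \<le> L \<longleftrightarrow> - (3 * i) \<le> L"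
    using par_cases[of "(i, j)"] q r by presburger
  moreover have "3 * i \<le> L + 1 \<longleftrightarrow> i \<le> (L + 1) div 3" "- (3 * i) \<le> L \<longleftrightarrow> - (L div 3) \<le> i"
    by presburger+
  ultimately have "\<bar>3 * i - par (i, j)\<bar> \<le> L \<longleftrightarrow> - (L div 3) \<le> i \<and> i \<le> (L + 1) div 3"
    by (auto simp: abs_le_iff)
  then show ?thesis
    unfolding height_le_iff L_def by auto
qed

definition row :: "int \<Rightarrow> int" where
  "row L = L div 3 + (L + 1) div 3 + 1"

lemma row_mod_3: "row (3 * c) = 2 * c + 1" "row (3 * c + 1) = 2 * c + 1" "row (3 * c + 2) = 2 * c + 2"
  unfolding row_def by presburger+

lemma mod_3_cases:
  obtains c where "n = 3 * c" | c where "n = 3 * c + 1" | c where "n = 3 * c + (2 :: int)"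
proof -
  have "n = 3 * (n div 3) \<or> n = 3 * (n div 3) + 1 \<or> n = 3 * (n div 3) + 2"
    by presburger
  then show ?thesis using that by blast
qed

lemma mod_3_eqs: "(3 * c) mod 3 = 0" "(3 * c + 1) mod 3 = 1" "(3 * c + 2) mod 3 = (2 :: int)"
  by presburger+

text \<open>The right side is \<open>F n - F (n - 1)\<close> for
  \<open>F n = n * n + n + of_bool (n mod 3 = 1)\<close>; thus the sum over rows telescopes in
  \<open>sum_rows\<close>.\<close>

lemma row_step: "3 * row (n - 1) = 2 * n + of_bool (n mod 3 = 1) - of_bool ((n - 1) mod 3 = 1)"
proof (cases n rule: mod_3_cases)
  case (1 c)
  then have "n - 1 = 3 * (c - 1) + 2" by simp
  then show ?thesis unfolding \<open>n - 1 = _\<close> unfolding 1 row_mod_3 mod_3_eqs by simp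
next
  case (2 c)
  then have "n - 1 = 3 * c" by simp
  then show ?thesis unfolding \<open>n - 1 = _\<close> unfolding 2 row_mod_3 mod_3_eqs by simp
next
  case (3 c)
  then have "n - 1 = 3 * c + 1" by simp
  then show ?thesis unfolding \<open>n - 1 = _\<close> unfolding 3 row_mod_3 mod_3_eqs by simp
qed

lemma row_double: "3 * row (2 * n) + 2 * of_bool (2 * n mod 3 = 1) - 2 * of_bool (n mod 3 = 1) =
  4 * n + 3 - 3 * of_bool (n mod 3 = 1)"
proof (cases n rule: mod_3_cases)
  case (1 c)
  then have "2 * n = 3 * (2 * c)" by simp
  then show ?thesis unfolding \<open>2 * n = _\<close> unfolding 1 row_mod_3 mod_3_eqs by simp
next
  case (2 c)
  then have "2 * n = 3 * (2 * c) + 2" by simp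
  then show ?thesis unfolding \<open>2 * n = _\<close> unfolding 2 row_mod_3 mod_3_eqs by simp
next
  case (3 c)
  then have "2 * n = 3 * (2 * c + 1) + 1" by simp
  then show ?thesis unfolding \<open>2 * n = _\<close> unfolding 3 row_mod_3 mod_3_eqs by simp
qed

lemma sum_rows:
  assumes "int k \<le> L"
  shows "3 * (\<Sum>j\<in>{- int k..int k}. row (L - \<bar>j\<bar>)) =
    3 * row L + 2 * (L * L + L + of_bool (L mod 3 = 1)) -
    2 * ((L - int k) * (L - int k) + (L - int k) + of_bool ((L - int k) mod 3 = 1))"
  using assms
proof (induction k)
  case (Suc k)
  have "3 * (\<Sum>j\<in>{- int (Suc k)..int (Suc k)}. row (L - \<bar>j\<bar>)) =
      3 * (\<Sum>j\<in>{- int k..int k}. row (L - \<bar>j\<bar>)) + 2 * (3 * row (L - int k - 1))"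
    unfolding sum_symmetric[of "\<lambda>j. row (L - j)"] by (simp add: algebra_simps)
  then show ?case
    using Suc unfolding row_step by (simp add: algebra_simps)
qed simp

lemma finite_height: "finite {v. height v \<le> k}"
proof (rule finite_subset)
  show "{v. height v \<le> k} \<subseteq> {- 2 * k..2 * k} \<times> {- k..k}"
  proof
    fix v assume "v \<in> {v. height v \<le> k}"
    then have "\<bar>snd v\<bar> \<le> k" "\<bar>3 * fst v - par v\<bar> + \<bar>snd v\<bar> \<le> 2 * k"
      by (simp_all add: height_le_iff)
    then have "\<bar>snd v\<bar> \<le> k" "\<bar>fst v\<bar> \<le> 2 * k"
      using par_cases[of v] by linarith+
    then show "v \<in> {- 2 * k..2 * k} \<times> {- k..k}"
      by (simp add: mem_Times_iff abs_le_iff)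
  qed
qed simp

lemma card_height: "3 * int (card {v. height v \<le> int k}) = 6 * int k * int k + 6 * int k + 3 - 3 * of_bool (k mod 3 = 1)"
proof -
  let ?S = "SIGMA j:{- int k..int k}. {- ((2 * int k - \<bar>j\<bar>) div 3)..(2 * int k - \<bar>j\<bar> + 1) div 3}"
  have "{v. height v \<le> int k} = prod.swap ` ?S"
    by (auto simp: row_iff image_iff)
  then have "card {v. height v \<le> int k} = card ?S"
    by (simp add: card_image)
  then have "int (card {v. height v \<le> int k}) = (\<Sum>j\<in>{- int k..int k}. row (2 * int k - \<bar>j\<bar>))"
    by (auto simp: row_def intro!: sum.cong)
  then have "3 * int (card {v. height v \<le> int k}) =
      3 * row (2 * int k) + 6 * int k * int k + 2 * int k + 2 * of_bool (2 * int k mod 3 = 1) - 2 * of_bool (int k mod 3 = 1)"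
    using sum_rows[of k "2 * int k"] by (simp add: algebra_simps)
  moreover have "int k mod 3 = 1 \<longleftrightarrow> k mod 3 = 1"
    by presburger
  ultimately show ?thesis using row_double[of "int k"] by simp
qed

text \<open>Induction by layers: raising \<open>n\<close> by one adds one for every vertex of height
  at most \<open>n\<close>, a number given by \<open>card_height\<close>. The quotient
  \<open>(n + 1) div 3\<close> counts the \<open>k < n\<close> with
  \<open>k mod 3 = 1\<close>.\<close>

lemma sum_layers:
  "3 * (\<Sum>v | height v < int n. int n - height v) = 2 * int n ^ 3 + int n - 3 * int ((n + 1) div 3)"
proof (induction n)
  case 0
  have "\<not> height v < 0" for v
    using height_nonneg[of v] by simp
  then show ?case by simp
next
  case (Suc n)
  have eq: "{v. height v < int (Suc n)} = {v. height v \<le> int n}" by auto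
  have "(\<Sum>v | height v < int (Suc n). int (Suc n) - height v) = (\<Sum>v | height v \<le> int n. (int n - height v) + 1)"
    unfolding eq by (rule sum.cong) auto
  also have "\<dots> = (\<Sum>v | height v \<le> int n. int n - height v) + int (card {v. height v \<le> int n})"
    by (simp add: sum.distrib)
  also have "(\<Sum>v | height v \<le> int n. int n - height v) = (\<Sum>v | height v < int n. int n - height v)"
    by (rule sum.mono_neutral_right) (use finite_height in auto)
  finally have "3 * (\<Sum>v | height v < int (Suc n). int (Suc n) - height v) =
      2 * int n ^ 3 + int n - 3 * int ((n + 1) div 3) + (6 * int n * int n + 6 * int n + 3 - 3 * of_bool (n mod 3 = 1))"
    using Suc.IH card_height[of n] by simp
  moreover have "int ((Suc n + 1) div 3) = int ((n + 1) div 3) + of_bool (n mod 3 = 1)"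
    unfolding of_bool_def by (cases "n mod 3 = 1") presburger+
  ultimately show ?case
    by (simp add: algebra_simps power3_eq_cube)
qed

text \<open>The hexagon of bounded height is turned by 30 degrees against the ball of the graph
  distance, so it sticks out only near its six corners, and there only in its outermost
  layer.\<close>

lemma outside_even:
  assumes "4 * m \<le> hex_norm v" "height v \<le> 3 * m" "1 \<le> m"
  shows "v \<in> {(2 * m, 0), (- 2 * m, 0), (m, 3 * m), (m, - 3 * m), (- m, 3 * m), (- m, - 3 * m)} \<and> 3 * m \<le> height v"
proof -
  obtain i j where v: "v = (i, j)" by (metis surj_pair)
  obtain t where t: "par v = t" "t = 0 \<or> t = 1" using par_cases by blast
  have h: "\<bar>j\<bar> \<le> height v" "\<bar>3 * i - t\<bar> + \<bar>j\<bar> \<le> 2 * height v"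
    using height_ge[of v] t by (simp_all add: v)
  have "\<bar>i\<bar> + \<bar>j\<bar> \<ge> 4 * m \<or> \<bar>2 * i - t\<bar> \<ge> 4 * m"
    using assms(1) t unfolding hex_norm_eq by (auto simp: v)
  then have "(i = 2 * m \<and> j = 0) \<or> (i = - 2 * m \<and> j = 0) \<or> (i = m \<and> \<bar>j\<bar> = 3 * m) \<or> (i = - m \<and> \<bar>j\<bar> = 3 * m)"
    using h assms(2,3) t(2) by (smt (verit))
  moreover from this have "3 * m \<le> height v"
    using h t(2) assms(3) by (smt (verit))
  ultimately show ?thesis
    unfolding v by auto
qed

lemma outside_odd:
  assumes "4 * m + 1 \<le> hex_norm v" "height v \<le> 3 * m + 1" "1 \<le> m"
  shows "v \<in> {(2 * m + 1, 0), (- 2 * m, 1), (- 2 * m, - 1), (m, 3 * m + 1), (m, - (3 * m + 1)),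
    (- m, 3 * m + 1), (- m, - (3 * m + 1)), (m + 1, 3 * m), (m + 1, - 3 * m)} \<and> 3 * m + 1 \<le> height v"
proof -
  obtain i j where v: "v = (i, j)" by (metis surj_pair)
  obtain t where t: "par v = t" "t = 0 \<or> t = 1" using par_cases by blast
  obtain q where q: "t = i + j - 2 * q" using par_half[of v] t by (auto simp: v)
  have h: "\<bar>j\<bar> \<le> height v" "\<bar>3 * i - t\<bar> + \<bar>j\<bar> \<le> 2 * height v"
    using height_ge[of v] t by (simp_all add: v)
  have "\<bar>i\<bar> + \<bar>j\<bar> \<ge> 4 * m + 1 \<or> \<bar>2 * i - t\<bar> \<ge> 4 * m + 1"
    using assms(1) t unfolding hex_norm_eq by (auto simp: v)
  then have "(i = 2 * m + 1 \<and> j = 0) \<or> (i = - 2 * m \<and> \<bar>j\<bar> = 1) \<or> (i = m \<and> \<bar>j\<bar> = 3 * m + 1) \<or>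
      (i = - m \<and> \<bar>j\<bar> = 3 * m + 1) \<or> (i = m + 1 \<and> \<bar>j\<bar> = 3 * m)"
  proof
    assume "\<bar>i\<bar> + \<bar>j\<bar> \<ge> 4 * m + 1"
    then show ?thesis using h assms(2,3) t(2) by (smt (verit))
  next
    assume *: "\<bar>2 * i - t\<bar> \<ge> 4 * m + 1"
    then have "(i = 2 * m + 1 \<and> j = 0) \<or> (i = - 2 * m \<and> t = 1 \<and> \<bar>j\<bar> \<le> 1)"
      using h assms(2,3) t(2) by (smt (verit))
    \<comment> \<open>The vertex \<open>(- 2 * m, 0)\<close> has even coordinate sum and hence type
      0.\<close>
    moreover have "j \<noteq> 0" if "i = - 2 * m" "t = 1"
    proof
      assume "j = 0"
      then have "2 * (m + q) = - 1" using q that by simp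
      then show False by presburger
    qed
    ultimately show ?thesis by linarith
  qed
  moreover from this have "3 * m + 1 \<le> height v"
    using h t(2) assms(3) by (smt (verit))
  ultimately show ?thesis
    using assms(3) unfolding v by (elim disjE conjE) (auto simp: abs_eq_iff')
qed

lemma finite_hex_norm: "finite {v. hex_norm v \<le> k}"
proof (rule finite_subset)
  show "{v. hex_norm v \<le> k} \<subseteq> {- k..k} \<times> {- k..k}"
  proof
    fix v assume "v \<in> {v. hex_norm v \<le> k}"
    then have "\<bar>fst v\<bar> \<le> k" "\<bar>snd v\<bar> \<le> k"
      using hex_norm_ge(1)[of v] by simp_all
    then show "v \<in> {- k..k} \<times> {- k..k}"
      by (simp add: mem_Times_iff abs_le_iff)
  qed
qed simp

text \<open>
  \<open>S\<close> contains the vertices of positive tent value outside the region, and \<open>X\<close> the vertices near the origin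
  whose weight was raised; for odd \<open>p\<close> the weight of the origin itself was lowered.
\<close>

lemma sum_weight_ge:
  assumes p: "1 \<le> p" and n: "peak p = 2 * int n"
    and out: "{v. height v < int n \<and> outer_radius p < hex_norm v} \<subseteq> S" "finite S"
      "\<And>v. height v < int n \<Longrightarrow> outer_radius p < hex_norm v \<Longrightarrow> int n \<le> height v + 1"
    and X: "X \<subseteq> {v. height v < int n \<and> hex_norm v \<le> outer_radius p}"
    and bonus: "\<And>v. height v < int n \<Longrightarrow> hex_norm v \<le> outer_radius p \<Longrightarrow>
      tent p v + 2 * of_bool (v \<in> X) - 2 * of_bool (odd p \<and> v = (0, 0)) \<le> weight p v"
  shows "2 * (\<Sum>v | height v < int n. int n - height v) - 2 * int (card S) + 2 * int (card X) - 2 * of_bool (odd p)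
    - int (card {v. height v < int n \<and> hex_norm v \<le> outer_radius p \<and> corrected p v}) \<le> (\<Sum>v | hex_norm v \<le> outer_radius p. weight p v)"
proof -
  let ?H = "{v. height v < int n}" and ?B = "{v. hex_norm v \<le> outer_radius p}"
  let ?I = "{v. height v < int n \<and> hex_norm v \<le> outer_radius p}" and ?O = "{v. height v < int n \<and> outer_radius p < hex_norm v}"
  have fin: "finite ?H" "finite ?B" "finite ?I" "finite ?O"
    using finite_height[of "int n"] finite_hex_norm[of "outer_radius p"] by (auto elim!: rev_finite_subset)
  have H: "?H = ?I \<union> ?O" "?I \<inter> ?O = {}" by auto
  \<comment> \<open>By \<open>out(3)\<close> the vertices outside the region lie in the outermost
    layer and count at most one each.\<close>
  have "(\<Sum>v\<in>?O. int n - height v) \<le> (\<Sum>v\<in>?O. 1)"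
    using out(3) by (intro sum_mono) (auto simp: algebra_simps)
  also have "\<dots> \<le> int (card S)"
    using card_mono[OF out(2,1)] by simp
  finally have O: "(\<Sum>v\<in>?O. int n - height v) \<le> int (card S)" .
  have "(\<Sum>v\<in>?I. 2 * (int n - height v) - of_bool (corrected p v) + 2 * of_bool (v \<in> X) - 2 * of_bool (odd p \<and> v = (0, 0)))
      \<le> (\<Sum>v\<in>?I. weight p v)"
    using bonus by (intro sum_mono) (auto simp: tent_def n)
  also have "\<dots> \<le> (\<Sum>v\<in>?B. weight p v)"
    using fin weight_nonneg[OF p] by (intro sum_mono2) auto
  also have "(\<Sum>v\<in>?I. 2 * (int n - height v) - of_bool (corrected p v) + 2 * of_bool (v \<in> X) - 2 * of_bool (odd p \<and> v = (0, 0))) =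
      2 * (\<Sum>v\<in>?I. int n - height v) - (\<Sum>v\<in>?I. of_bool (corrected p v)) + 2 * (\<Sum>v\<in>?I. of_bool (v \<in> X)) -
      2 * (\<Sum>v\<in>?I. of_bool (odd p \<and> v = (0, 0)))"
    by (simp add: sum.distrib sum_subtractf sum_distrib_left)
  also have "(\<Sum>v\<in>?I. of_bool (corrected p v)) = int (card {v. height v < int n \<and> hex_norm v \<le> outer_radius p \<and> corrected p v})"
    using fin(3) by (simp add: of_bool_def sum.If_cases Collect_conj_eq Int_assoc)
  also have "(\<Sum>v\<in>?I. of_bool (v \<in> X)) = int (card X)"
    using fin(3) X by (simp add: of_bool_def sum.If_cases Int_absorb1)
  finally have *: "2 * (\<Sum>v\<in>?I. int n - height v) - int (card {v. height v < int n \<and> hex_norm v \<le> outer_radius p \<and> corrected p v}) +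
      2 * int (card X) - 2 * (\<Sum>v\<in>?I. of_bool (odd p \<and> v = (0, 0))) \<le> (\<Sum>v\<in>?B. weight p v)" .
  have "(\<Sum>v\<in>?I. of_bool (odd p \<and> v = (0, 0))) \<le> (\<Sum>v\<in>?I. of_bool (v = (0, 0)) * of_bool (odd p) :: int)"
    by (intro sum_mono) simp
  also have "\<dots> = (\<Sum>v\<in>?I. of_bool (v = (0, 0))) * of_bool (odd p)"
    by (simp add: sum_distrib_right)
  also have "(\<Sum>v\<in>?I. of_bool (v = (0, 0))) \<le> (1 :: int)"
    using fin(3) by (simp add: of_bool_def sum.If_cases card_le_Suc0_iff_eq)
  finally have "(\<Sum>v\<in>?I. of_bool (odd p \<and> v = (0, 0))) \<le> (of_bool (odd p) :: int)"
    by simp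
  moreover have "(\<Sum>v\<in>?H. int n - height v) = (\<Sum>v\<in>?I. int n - height v) + (\<Sum>v\<in>?O. int n - height v)"
    unfolding H(1) using fin H(2) by (intro sum.union_disjoint) auto
  ultimately show ?thesis
    using * O by simp
qed

section \<open>Counting the corrected vertices\<close>

lemma sextant_add_6: "sextant (k + n * 6) = sextant k" "profile_at (k + n * 6) = profile_at k"
proof (induction n)
  case (Suc n)
  have e: "k + Suc n * 6 = Suc (Suc (Suc (Suc (Suc (Suc (k + n * 6))))))" by simp
  case 1 show ?case unfolding e sextant_periodic by (rule Suc)
  case 2 show ?case unfolding e sextant_periodic by (rule Suc)
qed simp_all

lemma sextant_mod: "sextant (k mod 6) = sextant k" "profile_at (k mod 6) = profile_at k"
  using sextant_add_6[of "k mod 6" "k div 6"] by simp_all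

text \<open>On the axis of a sextant two coordinates agree and the type is fixed, which leaves one
  parameter \<open>b\<close>: one ray in each sextant, three rays of each type.\<close>

lemma corrected_cases:
  assumes "corrected p v"
  obtains b where "1 \<le> b" "v \<in> {(2 * b, 0), (- b, 3 * b), (- b, - (3 * b))}"
  | b where "1 \<le> b" "v \<in> {(1 - 2 * b, 0), (b, 3 * b - 1), (b, - (3 * b - 1))}"
proof -
  obtain l where "sextant l v" "axial (even l) (profile_at l v)"
    using assms by (auto simp: corrected_def)
  then obtain k where k: "k < 6" "sextant k v" "axial (even k) (profile_at k v)"
    using sextant_mod[of l] by (metis mod_less_divisor zero_less_numeral axial_def even_mod_2_iff dvd_mod_iff even_numeral)
  have c: "xc 0 v = fst v" "2 * yc 0 v = par v - fst v + snd v" "2 * zc 0 v = par v - fst v - snd v"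
    using cube_0[of v] cube_1[of v] cube_2[of v]
    unfolding xc_def yc_def zc_def mult_0_right add_0 One_nat_def by auto
  have ax: "par v = (if even k then 0 else 1)" "yc k v = zc k v"
    using k(3) by (auto simp: axial_def profile_at_simps split: if_splits)
  from k(1) consider "k = 0" | "k = Suc 0" | "k = Suc (Suc 0)" | "k = Suc (Suc (Suc 0))"
    | "k = Suc (Suc (Suc (Suc 0)))" | "k = Suc (Suc (Suc (Suc (Suc 0))))"
    unfolding less_6 by blast
  then show ?thesis
  proof cases
    case 1
    with k ax c have "1 \<le> - yc 0 v" "v = (2 * (- yc 0 v), 0)"
      by (auto simp: sextant_def prod_eq_iff)
    then show ?thesis using that(1)[of "- yc 0 v"] by simp
  next
    case 2
    with k ax c have "1 \<le> xc 0 v" "v = (xc 0 v, 3 * xc 0 v - 1)"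
      by (auto simp: sextant_def prod_eq_iff)
    then show ?thesis using that(2)[of "xc 0 v"] by simp
  next
    case 3
    with k ax c have "1 \<le> - xc 0 v" "v = (- (- xc 0 v), 3 * (- xc 0 v))"
      by (auto simp: sextant_def prod_eq_iff)
    then show ?thesis using that(1)[of "- xc 0 v"] by simp
  next
    case 4
    with k ax c have "1 \<le> yc 0 v" "v = (1 - 2 * yc 0 v, 0)"
      by (auto simp: sextant_def prod_eq_iff)
    then show ?thesis using that(2)[of "yc 0 v"] by simp
  next
    case 5
    with k ax c have "1 \<le> - xc 0 v" "v = (- (- xc 0 v), - (3 * (- xc 0 v)))"
      by (auto simp: sextant_def prod_eq_iff)
    then show ?thesis using that(1)[of "- xc 0 v"] by simp
  next
    case 6
    with k ax c have "1 \<le> xc 0 v" "v = (xc 0 v, - (3 * xc 0 v - 1))"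
      by (auto simp: sextant_def prod_eq_iff)
    then show ?thesis using that(2)[of "xc 0 v"] by simp
  qed
qed

lemma par_eqs: "par (2 * b, 0) = 0" "par (- b, 3 * b) = 0" "par (- b, - (3 * b)) = 0"
  "par (1 - 2 * b, 0) = 1" "par (b, 3 * b - 1) = 1" "par (b, 1 - 3 * b) = 1"
  unfolding par_def fst_conv snd_conv by presburger+

lemma height_axis0: "1 \<le> b \<Longrightarrow> v \<in> {(2 * b, 0), (- b, 3 * b), (- b, - (3 * b))} \<Longrightarrow> height v = 3 * b \<and> hex_norm v = 4 * b"
  by (auto simp: height_def hex_norm_eq par_eqs)

lemma height_axis1: "1 \<le> b \<Longrightarrow> v \<in> {(1 - 2 * b, 0), (b, 3 * b - 1), (b, - (3 * b - 1))} \<Longrightarrow> height v = 3 * b - 1"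
  by (auto simp: height_def par_eqs)

lemma card_axis:
  assumes "A \<subseteq> (\<Union>b\<in>B. {f b, g b, h b}) \<union> (\<Union>b\<in>C. {f' b, g' b, h' b})" "finite B" "finite C"
  shows "card A \<le> 3 * card B + 3 * card C"
proof -
  have *: "card (\<Union>b\<in>B. {f b, g b, h b}) \<le> 3 * card B" if "finite B" for B f g h
  proof -
    have "card (\<Union>b\<in>B. {f b, g b, h b}) \<le> (\<Sum>b\<in>B. card {f b, g b, h b})"
      by (rule card_UN_le[OF that])
    also have "\<dots> \<le> (\<Sum>b\<in>B. 3)"
      by (intro sum_mono) (auto simp: card_insert_if)
    finally show ?thesis by simp
  qed
  have "card A \<le> card ((\<Union>b\<in>B. {f b, g b, h b}) \<union> (\<Union>b\<in>C. {f' b, g' b, h' b}))"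
    using assms by (intro card_mono) auto
  also have "\<dots> \<le> card (\<Union>b\<in>B. {f b, g b, h b}) + card (\<Union>b\<in>C. {f' b, g' b, h' b})"
    by (rule card_Un_le)
  also have "\<dots> \<le> 3 * card B + 3 * card C"
    using *[OF assms(2)] *[OF assms(3)] add_mono by blast
  finally show ?thesis .
qed

lemma card_corrected_odd:
  assumes "p = 2 * int m + 1"
  shows "card {v. height v < 3 * int m + 2 \<and> hex_norm v \<le> outer_radius p \<and> corrected p v} \<le> 6 * m"
proof -
  have "{v. height v < 3 * int m + 2 \<and> hex_norm v \<le> outer_radius p \<and> corrected p v} \<subseteq>
    (\<Union>b\<in>{1..int m}. {(2 * b, 0), (- b, 3 * b), (- b, - (3 * b))}) \<union>
    (\<Union>b\<in>{1..int m}. {(1 - 2 * b, 0), (b, 3 * b - 1), (b, - (3 * b - 1))})"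
  proof
    fix v assume v: "v \<in> {v. height v < 3 * int m + 2 \<and> hex_norm v \<le> outer_radius p \<and> corrected p v}"
    then have "corrected p v" by simp
    then show "v \<in> (\<Union>b\<in>{1..int m}. {(2 * b, 0), (- b, 3 * b), (- b, - (3 * b))}) \<union>
      (\<Union>b\<in>{1..int m}. {(1 - 2 * b, 0), (b, 3 * b - 1), (b, - (3 * b - 1))})"
    proof (cases rule: corrected_cases)
      case (1 b)
      with height_axis0[OF 1] v have "b \<in> {1..int m}" by simp
      with 1 show ?thesis by blast
    next
      case (2 b)
      with height_axis1[OF 2] v have "b \<in> {1..int m}" by simp
      with 2 show ?thesis by blast
    qed
  qed
  from card_axis[OF this] show ?thesis by simp
qed

text \<open>Height at least \<open>2 * m + 1\<close> leaves the outer third of each ray; the lower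
  limits are \<open>(2 * m + 1) / 3\<close> and \<open>(2 * m + 2) / 3\<close> rounded up. At most
  \<open>2 * m\<close> vertices remain, while \<open>4 * m - 5\<close> is the most that
  \<open>sum_weight_even\<close> can afford.\<close>

lemma card_corrected_even:
  assumes "p = 2 * int m" "3 \<le> m"
  shows "card {v. height v < 3 * int m + 1 \<and> hex_norm v \<le> outer_radius p \<and> corrected p v} + 5 \<le> 4 * m"
proof -
  have outer_radius: "outer_radius p = 4 * int m - 1"
    using assms by (simp add: outer_radius_def)
  have "{v. height v < 3 * int m + 1 \<and> hex_norm v \<le> outer_radius p \<and> corrected p v} \<subseteq>
    (\<Union>b\<in>{(2 * int m + 3) div 3..int m - 1}. {(2 * b, 0), (- b, 3 * b), (- b, - (3 * b))}) \<union>
    (\<Union>b\<in>{(2 * int m + 4) div 3..int m}. {(1 - 2 * b, 0), (b, 3 * b - 1), (b, - (3 * b - 1))})"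
  proof
    fix v assume v: "v \<in> {v. height v < 3 * int m + 1 \<and> hex_norm v \<le> outer_radius p \<and> corrected p v}"
    then have "corrected p v" "2 * int m + 1 \<le> height v"
      using assms by (auto simp: corrected_def)
    then show "v \<in> (\<Union>b\<in>{(2 * int m + 3) div 3..int m - 1}. {(2 * b, 0), (- b, 3 * b), (- b, - (3 * b))}) \<union>
      (\<Union>b\<in>{(2 * int m + 4) div 3..int m}. {(1 - 2 * b, 0), (b, 3 * b - 1), (b, - (3 * b - 1))})"
    proof (cases rule: corrected_cases)
      case (1 b)
      with height_axis0[OF 1] v \<open>2 * int m + 1 \<le> height v\<close> outer_radius have "2 * int m + 1 \<le> 3 * b" "4 * b \<le> 4 * int m - 1"
        by auto
      then have "(2 * int m + 3) div 3 \<le> b" "b \<le> int m - 1"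
        by linarith+
      with 1 show ?thesis by auto
    next
      case (2 b)
      with height_axis1[OF 2] v \<open>2 * int m + 1 \<le> height v\<close> have "2 * int m + 1 \<le> 3 * b - 1" "3 * b - 1 < 3 * int m + 1"
        by auto
      then have "(2 * int m + 4) div 3 \<le> b" "b \<le> int m"
        by linarith+
      with 2 show ?thesis by auto
    qed
  qed
  from card_axis[OF this]
  have "card {v. height v < 3 * int m + 1 \<and> hex_norm v \<le> outer_radius p \<and> corrected p v} \<le>
    3 * nat (int m - (2 * int m + 3) div 3) + 3 * nat (int m + 1 - (2 * int m + 4) div 3)"
    by simp
  moreover have "2 * int m + 1 \<le> 3 * ((2 * int m + 3) div 3)" "2 * int m + 2 \<le> 3 * ((2 * int m + 4) div 3)"
    by presburger+
  moreover have "int (nat (int m - (2 * int m + 3) div 3)) = int m - (2 * int m + 3) div 3"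
    "int (nat (int m + 1 - (2 * int m + 4) div 3)) = int m + 1 - (2 * int m + 4) div 3"
    using assms(2) by linarith+
  ultimately have "int (card {v. height v < 3 * int m + 1 \<and> hex_norm v \<le> outer_radius p \<and> corrected p v}) \<le> 2 * int m"
    by linarith
  with assms(2) show ?thesis by linarith
qed

section \<open>Counting the ball of the graph distance\<close>

lemma sum_columns:
  "(\<Sum>i\<in>{- int k..int k}. 2 * (c - \<bar>i\<bar>) + 1) = (2 * int k + 1) * (2 * c + 1) - 2 * int k * (int k + 1)"
proof (induction k)
  case (Suc k)
  then show ?case
    unfolding sum_symmetric[of "\<lambda>i. 2 * (c - i) + 1"] by (simp add: algebra_simps)
qed simp

lemma card_column_region:
  assumes "int k \<le> c"
  shows "int (card (SIGMA i:{- int k..int k}. {- (c - \<bar>i\<bar>)..c - \<bar>i\<bar>})) =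
    (2 * int k + 1) * (2 * c + 1) - 2 * int k * (int k + 1)"
proof -
  have "int (card (SIGMA i:{- int k..int k}. {- (c - \<bar>i\<bar>)..c - \<bar>i\<bar>})) =
    (\<Sum>i\<in>{- int k..int k}. int (card {- (c - \<bar>i\<bar>)..c - \<bar>i\<bar>}))"
    by (subst card_SigmaI) auto
  also have "\<dots> = (\<Sum>i\<in>{- int k..int k}. 2 * (c - \<bar>i\<bar>) + 1)"
    using assms by (intro sum.cong) auto
  finally show ?thesis by (simp only: sum_columns)
qed

text \<open>The ball consists of the columns with \<open>\<bar>i\<bar> \<le> m\<close>, cut out by
  the diamond, and of at most \<open>m + 1\<close> type 1 vertices in column
  \<open>m + 1\<close>.\<close>

lemma card_ball_odd: "int (card {v. hex_norm v \<le> 2 * int m + 1}) \<le> 6 * int m * int m + 9 * int m + 4"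
proof -
  let ?S = "SIGMA i:{- int m..int m}. {- (2 * int m + 1 - \<bar>i\<bar>)..2 * int m + 1 - \<bar>i\<bar>}"
  let ?C = "(\<lambda>l. (int m + 1, 2 * int l - int m)) ` {..m}"
  have "{v. hex_norm v \<le> 2 * int m + 1} \<subseteq> ?S \<union> ?C"
  proof
    fix v assume "v \<in> {v. hex_norm v \<le> 2 * int m + 1}"
    moreover obtain i j where v: "v = (i, j)" by (metis surj_pair)
    ultimately have b: "\<bar>i\<bar> + \<bar>j\<bar> \<le> 2 * int m + 1" "\<bar>2 * i - par v\<bar> \<le> 2 * int m + 1"
      using hex_norm_ge[of v] by simp_all
    have "- int m \<le> i" "i \<le> int m \<or> i = int m + 1 \<and> par v = 1"
      using b(2) par_cases[of v] by linarith+
    then consider "\<bar>i\<bar> \<le> int m" | "i = int m + 1" "par v = 1"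
      by linarith
    then show "v \<in> ?S \<union> ?C"
    proof cases
      case 1
      with b(1) show ?thesis by (auto simp: v)
    next
      case 2
      obtain q where "par v = i + j - 2 * q" using par_half[of v] by (auto simp: v)
      with 2 have j: "j = 2 * q - int m" by simp
      with b(1) 2 have "0 \<le> q" "q \<le> int m" by linarith+
      then have "v = (int m + 1, 2 * int (nat q) - int m)" "nat q \<in> {..m}"
        using 2 j by (simp_all add: v nat_le_iff)
      then show ?thesis by blast
    qed
  qed
  then have "card {v. hex_norm v \<le> 2 * int m + 1} \<le> card (?S \<union> ?C)"
    by (intro card_mono) auto
  also have "\<dots> \<le> card ?S + card ?C"
    by (rule card_Un_le)
  finally have "card {v. hex_norm v \<le> 2 * int m + 1} \<le> card ?S + (m + 1)"
    using card_image_le[of "{..m}" "\<lambda>l. (int m + 1, 2 * int l - int m)"] by simp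
  then have "int (card {v. hex_norm v \<le> 2 * int m + 1}) \<le> int (card ?S) + (int m + 1)"
    by linarith
  also have "int (card ?S) = (2 * int m + 1) * (2 * (2 * int m + 1) + 1) - 2 * int m * (int m + 1)"
    by (rule card_column_region) simp
  finally show ?thesis
    by (simp add: algebra_simps)
qed

text \<open>Of the truncated diamond, the leftmost column \<open>?T\<close> keeps only its vertices
  of type 0, listed in \<open>?C\<close>.\<close>

lemma card_ball_even: "int (card {v. hex_norm v \<le> 2 * int m}) \<le> 6 * int m * int m + 3 * int m + 1"
proof -
  let ?S = "SIGMA i:{- int m..int m}. {- (2 * int m - \<bar>i\<bar>)..2 * int m - \<bar>i\<bar>}"
  let ?T = "(\<lambda>j. (- int m, j)) ` {- int m..int m}"
  let ?C = "(\<lambda>l. (- int m, 2 * int l - int m)) ` {..m}"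
  have "{v. hex_norm v \<le> 2 * int m} \<subseteq> (?S - ?T) \<union> ?C"
  proof
    fix v assume "v \<in> {v. hex_norm v \<le> 2 * int m}"
    moreover obtain i j where v: "v = (i, j)" by (metis surj_pair)
    ultimately have b: "\<bar>i\<bar> + \<bar>j\<bar> \<le> 2 * int m" "\<bar>2 * i - par v\<bar> \<le> 2 * int m"
      using hex_norm_ge[of v] by simp_all
    have "i \<le> int m" "- int m < i \<or> i = - int m \<and> par v = 0"
      using b(2) par_cases[of v] by linarith+
    then consider "\<bar>i\<bar> \<le> int m" "- int m < i" | "i = - int m" "par v = 0"
      by linarith
    then show "v \<in> (?S - ?T) \<union> ?C"
    proof cases
      case 1
      with b(1) show ?thesis by (auto simp: v)
    next
      case 2
      obtain q where "par v = i + j - 2 * q" using par_half[of v] by (auto simp: v)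
      with 2 have j: "j = 2 * q + int m" by simp
      with b(1) 2 have "0 \<le> q + int m" "q + int m \<le> int m" by linarith+
      then have "v = (- int m, 2 * int (nat (q + int m)) - int m)" "nat (q + int m) \<in> {..m}"
        using 2 j by (simp_all add: v nat_le_iff)
      then show ?thesis by blast
    qed
  qed
  then have "card {v. hex_norm v \<le> 2 * int m} \<le> card ((?S - ?T) \<union> ?C)"
    by (intro card_mono) auto
  also have "\<dots> \<le> card (?S - ?T) + card ?C"
    by (rule card_Un_le)
  finally have le: "card {v. hex_norm v \<le> 2 * int m} \<le> card (?S - ?T) + (m + 1)"
    using card_image_le[of "{..m}" "\<lambda>l. (- int m, 2 * int l - int m)"] by simp
  have "card ?T = 2 * m + 1"
    by (subst card_image) (auto simp: inj_on_def)
  moreover have "?T \<subseteq> ?S" by auto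
  ultimately have "card (?S - ?T) + (2 * m + 1) = card ?S"
    using card_mono[of ?S ?T] by (simp add: card_Diff_subset)
  then have "int (card {v. hex_norm v \<le> 2 * int m}) \<le> int (card ?S) - int m"
    using le by linarith
  also have "int (card ?S) = (2 * int m + 1) * (2 * (2 * int m) + 1) - 2 * int m * (int m + 1)"
    by (rule card_column_region) simp
  finally show ?thesis
    by (simp add: algebra_simps)
qed

text \<open>Starting from the tent sum: six outside vertices cost 2 each, the three neighbours of
  the origin gain 2 each, and at most \<open>4 * m - 5\<close> corrections cost 1 each. After
  multiplication by 3 an excess of 3 remains.\<close>

lemma sum_weight_even:
  assumes m: "3 \<le> m" and p: "p = 2 * int m"
  shows "cap p * (int (card {v. hex_norm v \<le> p}) + int m - 1) < (\<Sum>v | hex_norm v \<le> outer_radius p. weight p v)"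
proof -
  define n where "n = 3 * m + 1"
  let ?S = "{(2 * int m, 0), (- 2 * int m, 0), (int m, 3 * int m), (int m, - 3 * int m), (- int m, 3 * int m), (- int m, - 3 * int m)}"
  let ?X = "{(1, 0), (0, 1), (0, - 1)} :: vert set"
  have outer_radius: "outer_radius p = 4 * int m - 1" and cap: "cap p = 6 * int m + 2" and peak: "peak p = 6 * int m + 2" and ev: "even p" and p2: "2 * p = 4 * int m"
    using p by (simp_all add: outer_radius_def cap_def peak_def)
  have X: "hex_norm v = 1 \<and> height v = 1" if "v \<in> ?X" for v
    using that by (auto simp: hex_norm_eq height_def par_def)
  have out: "v \<in> ?S \<and> int n \<le> height v + 1" if "height v < int n" "outer_radius p < hex_norm v" for v
  proof -
    have "4 * int m \<le> hex_norm v" "height v \<le> 3 * int m" "1 \<le> int m"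
      using that m by (simp_all add: n_def outer_radius)
    note * = outside_even[OF this]
    then have "int n \<le> height v + 1"
      unfolding n_def by linarith
    with * show ?thesis by blast
  qed
  have "2 * (\<Sum>v | height v < int n. int n - height v) - 2 * int (card ?S) + 2 * int (card ?X) - 2 * of_bool (odd p)
    - int (card {v. height v < int n \<and> hex_norm v \<le> outer_radius p \<and> corrected p v}) \<le> (\<Sum>v | hex_norm v \<le> outer_radius p. weight p v)"
  proof (rule sum_weight_ge)
    show "1 \<le> p" "peak p = 2 * int n"
      using m p peak by (simp, simp only: peak n_def, simp)
    show "{v. height v < int n \<and> outer_radius p < hex_norm v} \<subseteq> ?S"
      using out by blast
    show "int n \<le> height v + 1" if "height v < int n" "outer_radius p < hex_norm v" for v
      using out that by blast
    show "?X \<subseteq> {v. height v < int n \<and> hex_norm v \<le> outer_radius p}"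
      using X m by (auto simp: n_def outer_radius)
    show "tent p v + 2 * of_bool (v \<in> ?X) - 2 * of_bool (odd p \<and> v = (0, 0)) \<le> weight p v"
      if "height v < int n" "hex_norm v \<le> outer_radius p" for v
    proof (cases "v \<in> ?X")
      case True
      then show ?thesis
        using X[OF True] m by (simp add: weight_def tent_def outer_radius cap peak p2)
    next
      case False
      then show ?thesis
        using ev tent_le[of p v] height_nonneg[of v] by (auto simp: weight_def cap peak)
    qed
  qed simp
  moreover have "card ?S \<le> 6"
    by (simp add: card_insert_if)
  moreover have "card ?X = 3"
    by simp
  moreover have "card {v. height v < int n \<and> hex_norm v \<le> outer_radius p \<and> corrected p v} + 5 \<le> 4 * m"
    using card_corrected_even[OF p m] by (simp add: n_def add.commute)
  moreover have "3 * (\<Sum>v | height v < int n. int n - height v) = 2 * int n ^ 3 + int n - 3 * int m"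
    using sum_layers[of n] by (simp add: n_def)
  ultimately have "3 * (\<Sum>v | hex_norm v \<le> outer_radius p. weight p v) \<ge> 2 * (2 * int n ^ 3 + int n - 3 * int m) - 18 - 3 * (4 * int m - 5)"
    using ev by simp
  moreover have "2 * (2 * int n ^ 3 + int n - 3 * int m) - 18 - 3 * (4 * int m - 5) =
      3 * (cap p * (6 * int m * int m + 3 * int m + 1 + int m - 1)) + 3"
    unfolding cap n_def by (simp add: algebra_simps power3_eq_cube)
  moreover have "cap p * (int (card {v. hex_norm v \<le> p}) + int m - 1) \<le> cap p * (6 * int m * int m + 3 * int m + 1 + int m - 1)"
    using card_ball_even[of m] by (intro mult_left_mono) (simp_all add: p cap[unfolded p])
  ultimately show ?thesis by linarith
qed

text \<open>Nine outside vertices cost 2 each, the six vertices at distance two from the origin gain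
  2 each, the origin loses 2, and at most \<open>6 * m\<close> corrections cost 1 each. After
  multiplication by 3 the excess is \<open>12 * m - 12\<close>, positive from \<open>m = 2\<close>
  on.\<close>

lemma sum_weight_odd:
  assumes m: "2 \<le> m" and p: "p = 2 * int m + 1"
  shows "cap p * (int (card {v. hex_norm v \<le> p}) + int m - 1) < (\<Sum>v | hex_norm v \<le> outer_radius p. weight p v)"
proof -
  define n where "n = 3 * m + 2"
  let ?S = "{(2 * int m + 1, 0), (- 2 * int m, 1), (- 2 * int m, - 1), (int m, 3 * int m + 1), (int m, - (3 * int m + 1)),
    (- int m, 3 * int m + 1), (- int m, - (3 * int m + 1)), (int m + 1, 3 * int m), (int m + 1, - 3 * int m)}"
  let ?X = "{(1, 1), (1, - 1), (- 1, 1), (- 1, - 1), (0, 2), (0, - 2)} :: vert set"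
  have outer_radius: "outer_radius p = 4 * int m" and cap: "cap p = 6 * int m + 2" and peak: "peak p = 6 * int m + 4" and od: "odd p" and p2: "2 * p = 4 * int m + 2"
    using p by (simp_all add: outer_radius_def cap_def peak_def)
  have X: "hex_norm v = 2 \<and> height v = 2" if "v \<in> ?X" for v
    using that by (auto simp: hex_norm_eq height_def par_def)
  have out: "v \<in> ?S \<and> int n \<le> height v + 1" if "height v < int n" "outer_radius p < hex_norm v" for v
  proof -
    have "4 * int m + 1 \<le> hex_norm v" "height v \<le> 3 * int m + 1" "1 \<le> int m"
      using that m by (simp_all add: n_def outer_radius)
    note * = outside_odd[OF this]
    then have "int n \<le> height v + 1"
      unfolding n_def by linarith
    with * show ?thesis by blast
  qed
  have "2 * (\<Sum>v | height v < int n. int n - height v) - 2 * int (card ?S) + 2 * int (card ?X) - 2 * of_bool (odd p)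
    - int (card {v. height v < int n \<and> hex_norm v \<le> outer_radius p \<and> corrected p v}) \<le> (\<Sum>v | hex_norm v \<le> outer_radius p. weight p v)"
  proof (rule sum_weight_ge)
    show "1 \<le> p" "peak p = 2 * int n"
      using m p peak by (simp, simp only: peak n_def, simp)
    show "{v. height v < int n \<and> outer_radius p < hex_norm v} \<subseteq> ?S"
      using out by blast
    show "int n \<le> height v + 1" if "height v < int n" "outer_radius p < hex_norm v" for v
      using out that by blast
    show "?X \<subseteq> {v. height v < int n \<and> hex_norm v \<le> outer_radius p}"
      using X m by (auto simp: n_def outer_radius)
    show "tent p v + 2 * of_bool (v \<in> ?X) - 2 * of_bool (odd p \<and> v = (0, 0)) \<le> weight p v"
      if "height v < int n" "hex_norm v \<le> outer_radius p" for v
    proof (cases "v \<in> ?X")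
      case True
      then show ?thesis
        using X[OF True] m by (simp add: weight_def tent_def outer_radius cap peak p2 od)
    next
      case False
      then show ?thesis
        using od tent_le[of p v] height_nonneg[of v] height_pos[of v] by (auto simp: weight_def cap peak)
    qed
  qed simp
  moreover have "card ?S \<le> 9"
    by (simp add: card_insert_if)
  moreover have "card ?X = 6"
    by simp
  moreover have "card {v. height v < int n \<and> hex_norm v \<le> outer_radius p \<and> corrected p v} \<le> 6 * m"
    using card_corrected_odd[OF p] by (simp add: n_def add.commute)
  moreover have "3 * (\<Sum>v | height v < int n. int n - height v) = 2 * int n ^ 3 + int n - 3 * (int m + 1)"
    using sum_layers[of n] by (simp add: n_def)
  ultimately have "3 * (\<Sum>v | hex_norm v \<le> outer_radius p. weight p v) \<ge> 2 * (2 * int n ^ 3 + int n - 3 * (int m + 1)) - 24 - 18 * int m"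
    using od by simp
  moreover have "2 * (2 * int n ^ 3 + int n - 3 * (int m + 1)) - 24 - 18 * int m =
      3 * (cap p * (6 * int m * int m + 9 * int m + 4 + int m - 1)) + 12 * int m - 12"
    unfolding cap n_def by (simp add: algebra_simps power3_eq_cube)
  moreover have "cap p * (int (card {v. hex_norm v \<le> p}) + int m - 1) \<le> cap p * (6 * int m * int m + 9 * int m + 4 + int m - 1)"
    using card_ball_odd[of m] by (intro mult_left_mono) (simp_all add: p cap[unfolded p])
  ultimately show ?thesis using m by linarith
qed

section \<open>Counting colours\<close>

definition translate :: "vert \<Rightarrow> vert \<Rightarrow> vert" where
  "translate x v = (fst x + fst v, snd x + snd v)"

text \<open>Translation by a right vertex preserves the type of every vertex, so everything may be
  computed around the origin.\<close>

lemma hdist_translate: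
  assumes "right_vertex x"
  shows "int (hdist (translate x u) (translate x v)) = hex_dist u v"
proof -
  have "par (translate x w) = par w" for w
    using assms mod_add_eq[of "fst x + snd x" 2 "fst w + snd w"]
    by (simp add: par_def translate_def right_vertex_def even_iff_mod_2_eq_zero algebra_simps)
  then show ?thesis
    unfolding hdist_eq_hex_dist hex_dist_def by (simp add: translate_def)
qed

lemma translate_0: "translate x (0, 0) = x"
  by (simp add: translate_def)

lemma inj_translate: "inj (translate x)"
  by (auto simp: inj_def translate_def prod_eq_iff)

lemma surj_translate: "\<exists>v. u = translate x v"
  by (rule exI[of _ "(fst u - fst x, snd u - snd x)"]) (simp add: translate_def)

lemma hdist_commute: "hdist u v = hdist v u"
  using hdist_eq_hex_dist[of u v] hdist_eq_hex_dist[of v u] hex_dist_commute[of u v] by simp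

lemma Collect_translate:
  assumes "\<And>v. P (translate x v) \<longleftrightarrow> Q v"
  shows "{u. P u} = translate x ` {v. Q v}"
proof (rule set_eqI)
  fix u
  obtain v where "u = translate x v" using surj_translate by blast
  then show "u \<in> {u. P u} \<longleftrightarrow> u \<in> translate x ` {v. Q v}"
    using assms inj_image_mem_iff[OF inj_translate] by simp
qed

lemma Dball_eq:
  assumes "right_vertex x"
  shows "Dball x p = translate x ` {v. hex_norm v \<le> int p}"
proof -
  have "hdist (translate x v) x \<le> p \<longleftrightarrow> hex_norm v \<le> int p" for v
    using hdist_translate[OF assms, of v "(0, 0)"] unfolding translate_0 by linarith
  then show ?thesis
    unfolding Dball_def by (rule Collect_translate)
qed

lemma annulus_eq:
  assumes "right_vertex x" "2 \<le> p"
  shows "(\<Union>q\<in>{1..2 * (p div 2) - 1}. sphere x (p + q)) = translate x ` {v. int p < hex_norm v \<and> hex_norm v \<le> outer_radius (int p)}"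
proof -
  have "(\<exists>q\<in>{1..2 * (p div 2) - 1}. hdist x (translate x v) = p + q) \<longleftrightarrow> int p < hex_norm v \<and> hex_norm v \<le> outer_radius (int p)" for v
  proof -
    have h: "int (hdist x (translate x v)) = hex_norm v"
      using hdist_translate[OF assms(1), of v "(0, 0)"] by (simp add: translate_0 hdist_commute)
    have "outer_radius (int p) = int (p + (2 * (p div 2) - 1))"
      using assms(2) by (simp add: outer_radius_def of_nat_diff)
    then have "int p < hex_norm v \<and> hex_norm v \<le> outer_radius (int p) \<longleftrightarrow>
        p < hdist x (translate x v) \<and> hdist x (translate x v) \<le> p + (2 * (p div 2) - 1)"
      unfolding h[symmetric] by (simp only: of_nat_less_iff of_nat_le_iff)
    also have "\<dots> \<longleftrightarrow> (\<exists>q\<in>{1..2 * (p div 2) - 1}. hdist x (translate x v) = p + q)"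
      by (auto intro!: bexI[of _ "hdist x (translate x v) - p"])
    finally show ?thesis by simp
  qed
  then have "{u. \<exists>q\<in>{1..2 * (p div 2) - 1}. hdist x u = p + q} = translate x ` {v. int p < hex_norm v \<and> hex_norm v \<le> outer_radius (int p)}"
    by (rule Collect_translate)
  then show ?thesis
    unfolding sphere_def by blast
qed

text \<open>Weak duality: the total weight splits over the colour classes, each of weight at most
  \<open>cap\<close>. The strict lower bound on the total then gains the last colour by
  integrality.\<close>

lemma card_colors:
  fixes g :: "vert \<Rightarrow> nat"
  assumes p: "5 \<le> p" and g: "\<And>u v. u \<noteq> v \<Longrightarrow> g u = g v \<Longrightarrow> 2 * int p < hex_dist u v"
  shows "card {v. hex_norm v \<le> int p} + p div 2 \<le> card (g ` {v. hex_norm v \<le> outer_radius (int p)})"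
proof -
  let ?B = "{v. hex_norm v \<le> outer_radius (int p)}"
  have pos: "0 < cap (int p)"
    using p by (simp add: cap_def)
  have "cap (int p) * (int (card {v. hex_norm v \<le> int p}) + int (p div 2) - 1) < (\<Sum>v\<in>?B. weight (int p) v)"
  proof (cases "even p")
    case True
    then obtain m where "p = 2 * m" by (elim evenE)
    then show ?thesis using sum_weight_even[of m "int p"] p by simp
  next
    case False
    then obtain m where "p = 2 * m + 1" by (elim oddE)
    then show ?thesis using sum_weight_odd[of m "int p"] p by simp
  qed
  also have "\<dots> = (\<Sum>c\<in>g ` ?B. \<Sum>v | v \<in> ?B \<and> g v = c. weight (int p) v)"
    by (rule sum.image_gen) (rule finite_hex_norm)
  also have "\<dots> \<le> (\<Sum>c\<in>g ` ?B. cap (int p))"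
    by (intro sum_mono sum_weight_le) (use p g finite_hex_norm in auto)
  also have "\<dots> = cap (int p) * int (card (g ` ?B))"
    by simp
  finally have "int (card {v. hex_norm v \<le> int p}) + int (p div 2) - 1 < int (card (g ` ?B))"
    using pos by (simp only: mult_less_cancel_left_pos)
  then show ?thesis by linarith
qed

text \<open>Any two vertices of the ball are within \<open>2 * p\<close> by the triangle inequality,
  so the ball uses as many colours as it has vertices. All further colours counted by
  \<open>card_colors\<close> occur in the annulus only.\<close>

lemma card_new_colors:
  assumes p: "5 \<le> p" and x: "right_vertex x" and f: "dist_coloring (2 * p) n f"
  shows "p div 2 \<le> card (f ` (\<Union>q\<in>{1..2 * (p div 2) - 1}. sphere x (p + q)) - f ` Dball x p)"
    and "card (Dball x p) + p div 2 \<le> n"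
proof -
  define g where "g = f \<circ> translate x"
  let ?D = "{v. hex_norm v \<le> int p}" and ?A = "{v. int p < hex_norm v \<and> hex_norm v \<le> outer_radius (int p)}"
  have range: "f u \<in> {1..n}" and distinct: "u \<noteq> v \<Longrightarrow> hdist u v \<le> 2 * p \<Longrightarrow> f u \<noteq> f v" for u v
    using f unfolding dist_coloring_def by blast+
  have far: "2 * int p < hex_dist u v" if "u \<noteq> v" "g u = g v" for u v
  proof (rule ccontr)
    assume "\<not> 2 * int p < hex_dist u v"
    then have "hdist (translate x u) (translate x v) \<le> 2 * p"
      using hdist_translate[OF x, of u v] by linarith
    moreover have "translate x u \<noteq> translate x v"
      using that(1) injD[OF inj_translate] by blast
    ultimately show False
      using distinct that(2) unfolding g_def comp_def by blast
  qed
  have "inj_on g ?D"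
  proof (rule inj_onI, rule ccontr)
    fix u v assume "u \<in> ?D" "v \<in> ?D" "g u = g v" "u \<noteq> v"
    then show False using far[of u v] hex_dist_triangle[of u v] by simp
  qed
  then have cD: "card (g ` ?D) = card ?D"
    by (rule card_image)
  have fin: "finite ?D" "finite ?A"
    using finite_hex_norm[of "int p"] finite_hex_norm[of "outer_radius (int p)"] by (auto elim!: rev_finite_subset)
  have "{v. hex_norm v \<le> outer_radius (int p)} = ?D \<union> ?A"
    using p by (auto simp: outer_radius_def)
  then have "card ?D + p div 2 \<le> card (g ` ?D \<union> g ` ?A)"
    using card_colors[OF p far] by (simp add: image_Un)
  also have "g ` ?D \<union> g ` ?A = g ` ?D \<union> (g ` ?A - g ` ?D)"
    by blast
  also have "card \<dots> = card ?D + card (g ` ?A - g ` ?D)"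
    using fin by (subst card_Un_disjoint) (auto simp: cD)
  finally have new: "p div 2 \<le> card (g ` ?A - g ` ?D)"
    by simp
  have fD: "f ` Dball x p = g ` ?D"
    unfolding Dball_eq[OF x] g_def by (simp add: image_comp)
  have fA: "f ` (\<Union>q\<in>{1..2 * (p div 2) - 1}. sphere x (p + q)) = g ` ?A"
    using p unfolding g_def by (subst annulus_eq[OF x]) (simp_all add: image_comp)
  show "p div 2 \<le> card (f ` (\<Union>q\<in>{1..2 * (p div 2) - 1}. sphere x (p + q)) - f ` Dball x p)"
    unfolding fD fA by (rule new)
  have "card (Dball x p) = card ?D"
    unfolding Dball_eq[OF x] by (rule card_image) (rule inj_on_subset[OF inj_translate subset_UNIV])
  then have "card (Dball x p) + p div 2 \<le> card (g ` ?D \<union> (g ` ?A - g ` ?D))"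
    using new fin by (subst card_Un_disjoint) (auto simp: cD)
  also have "\<dots> \<le> card {1..n}"
  proof (rule card_mono)
    have "g v \<in> {1..n}" for v
      unfolding g_def comp_def by (rule range)
    then show "g ` ?D \<union> (g ` ?A - g ` ?D) \<subseteq> {1..n}"
      by blast
  qed simp
  finally show "card (Dball x p) + p div 2 \<le> n"
    by simp
qed

theorem theorem3:
  fixes p :: nat and x :: vert and f :: "vert \<Rightarrow> nat" and n :: nat
  assumes "p \<ge> 5"
    and "right_vertex x"
    and "dist_coloring (2 * p) n f"
  shows "card (f ` (\<Union>q\<in>{1..2 * (p div 2) - 1}. sphere x (p + q)) - f ` Dball x p) \<ge> p div 2
         \<and> hex_lambda (2 * p) \<ge> card (Dball x p) + p div 2"
proof
  show "card (f ` (\<Union>q\<in>{1..2 * (p div 2) - 1}. sphere x (p + q)) - f ` Dball x p) \<ge> p div 2"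
    by (rule card_new_colors[OF assms])
  \<comment> \<open>The given colouring shows that the minimum is taken over a nonempty set and is
    therefore attained.\<close>
  have "\<exists>f. dist_coloring (2 * p) (hex_lambda (2 * p)) f"
    unfolding hex_lambda_def by (rule LeastI_ex) (use assms(3) in blast)
  then show "hex_lambda (2 * p) \<ge> card (Dball x p) + p div 2"
    using card_new_colors(2)[OF assms(1,2)] by blast
qed

end
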